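(* Consider the linear system $\dot{\mathbf{x}} = \mathbf{A}\mathbf{x} + \mathbf{B}\mathbf{u}$ with $\mathbf{A}\in\mathbb{R}^{n\times n}$, $\mathbf{B}\in\mathbb{R}^{n\times m}$, and affine constraint functions $h_i(\mathbf{x}) = \mathbf{c}_i^\top\mathbf{x}+d_i$, $i\in[\bar p]$, where $h_i$ has relative degree $r_i\geq 1$, together with constants $\alpha_{i,j}>0$ ($i\in[\bar p]$, $j\in[r_i]$). Let $\boldsymbol{\ell}_i = \mathbf{B}^\top(\mathbf{A}^{r_i-1})^\top\mathbf{c}_i$, and assume that $\{\boldsymbol{\ell}_i\}_{i=1}^{p}$ are linearly independent and $\{\boldsymbol{\ell}_i\}_{i=p+1}^{\bar p}$ are linear combinations of $\{\boldsymbol{\ell}_i\}_{i=1}^{p}$. Suppose that: 1. $d_i\geq 0$ for all $i\in[\bar p]$; 2. $\mathbf{c}_i^\top\boldsymbol{\Phi}_i(\mathbf{A})-\boldsymbol{\ell}_i^\top\mathbf{K}_0=\mathbf{0}_n^\top$ for all $i\in[\bar p]\setminus[p]$; 3. $(\mathbf{A}-\mathbf{B}\mathbf{K}_0,\mathbf{B}\mathbf{L}_\perp)$ is stabilizable. Let $\gamma>1$. Then there exists $\mathbf{K}\in\mathcal{M}$ with $\|\mathbf{S}_{\mathbf{K}}\|_\infty<\gamma$ if and only if there exist a symmetric positive definite matrix $\mathbf{X}\in\mathbb{R}^{n\times n}$ and a matrix $\mathbf{Y}\in\mathbb{R}^{m\times n}$ such that $$\begin{bmatrix}\mathbf{A}\mathbf{X}+\mathbf{X}\mathbf{A}^\top-\mathbf{B}\mathbf{Y}-\mathbf{Y}^\top\mathbf{B}^\top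 & \mathbf{B} & -\mathbf{Y}^\top\\ \mathbf{B}^\top & -\gamma\mathbf{I}_m & \mathbf{I}_m\\ -\mathbf{Y} & \mathbf{I}_m & -\gamma\mathbf{I}_m\end{bmatrix}\prec 0\qquad\text{and}\qquad \mathbf{L}^\top\mathbf{Y}=\tilde{\mathbf{C}}\mathbf{X}.$$ In that case, for any such $\mathbf{X},\mathbf{Y}$, the matrix $\mathbf{K}=\mathbf{Y}\mathbf{X}^{-1}$ satisfies $\mathbf{K}\in\mathcal{M}$ and $\|\mathbf{S}_{\mathbf{K}}\|_\infty<\gamma$.
   Context: $[k]=\{1,\dots,k\}$. For the linear system, $h_i(\mathbf{x})=\mathbf{c}_i^\top\mathbf{x}+d_i$ (with $\mathbf{c}_i\in\mathbb{R}^n$, $d_i\in\mathbb{R}$) has relative degree $r_i\in\mathbb{Z}_{>0}$ if $\mathbf{c}_i^\top\mathbf{A}^{r_i-1}\mathbf{B}\neq\mathbf{0}$ and $\mathbf{c}_i^\top\mathbf{A}^{k}\mathbf{B}=\mathbf{0}$ for all $0\le k<r_i-1$. Set $\boldsymbol{\Phi}_i(\mathbf{A})=\prod_{l=1}^{r_i}(\mathbf{A}+\alpha_{i,l}\mathbf{I}_n)$ and $\alpha_i=\prod_{j=1}^{r_i}\alpha_{i,j}$. The $i$-th HOCBF (high-order control barrier function) constraint on a pair $(\mathbf{x},\mathbf{u})$ is $\mathbf{c}_i^\top\boldsymbol{\Phi}_i(\mathbf{A})\mathbf{x}+\mathbf{c}_i^\top\mathbf{A}^{r_i-1}\mathbf{B}\mathbf{u}+\alpha_i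 d_i\geq 0$. $\mathbf{L}\in\mathbb{R}^{m\times p}$ is the matrix with columns $\boldsymbol{\ell}_1,\dots,\boldsymbol{\ell}_p$; $\mathbf{L}_\perp\in\mathbb{R}^{m\times(m-p)}$ is a matrix whose columns form a basis of $\ker(\mathbf{L}^\top)$ (empty if $m=p$); $\tilde{\mathbf{C}}\in\mathbb{R}^{p\times n}$ is the matrix whose $i$-th row is $\mathbf{c}_i^\top\boldsymbol{\Phi}_i(\mathbf{A})$, $i\in[p]$; $\mathbf{K}_0=\mathbf{L}(\mathbf{L}^\top\mathbf{L})^{-1}\tilde{\mathbf{C}}$. $\mathcal{M}\subseteq\mathbb{R}^{m\times n}$ is the set of gain matrices $\mathbf{K}$ such that $\mathbf{u}=-\mathbf{K}\mathbf{x}$ renders the origin globally exponentially stable (i.e. $\mathbf{A}-\mathbf{B}\mathbf{K}$ is Hurwitz: all eigenvalues have negative real part) and satisfies all $\bar p$ HOCBF constraints for all $\mathbf{x}\in\mathbb{R}^n$. For $\mathbf{K}$ with $\mathbf{A}-\mathbf{B}\mathbf{K}$ Hurwitz, the input sensitivity transfer matrix is $\mathbf{S}_{\mathbf{K}}(s)=\mathbf{I}_m-\mathbf{K}\big(s\mathbf{I}_n-(\mathbf{A}-\mathbf{B}\mathbf{K})\big)^{-1}\mathbf{B}$, and $\|\mathbf{S}_{\mathbf{K}}\|_\infty=\sup_{\omega\in\mathbb{R}}\sigma(\mathbf{S}_{\mathbf{K}}(j\omega))$, where $\sigma(\cdot)$ is the maximum singular value and $j$ the imaginary unit. A pair $(\mathbf{F},\mathbf{G})$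 is stabilizable if there is a matrix $\mathbf{H}$ with $\mathbf{F}-\mathbf{G}\mathbf{H}$ Hurwitz (if $\mathbf{G}$ has no columns, this means $\mathbf{F}$ is Hurwitz). $\prec 0$ means negative definite. *)

theory Defs
  imports "HOL-Analysis.Analysis"
begin

text \<open>
  Matrices with \<open>m\<close> rows and \<open>n\<close> columns are \<open>real^'n^'m\<close>. On this type \<open>*\<close>, \<open>^\<close> and \<open>inverse\<close> do not
  denote the matrix operations; only \<open>**\<close>, \<open>*v\<close>, \<open>v*\<close>, \<open>matrix_inv\<close> and \<open>matpow\<close> below are used.
  \<open>mat a\<close> is \<open>a\<close> times the identity matrix.
\<close>

primrec matpow :: "'a::semiring_1^'n^'n \<Rightarrow> nat \<Rightarrow> 'a^'n^'n" where
  "matpow A 0 = mat 1"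
| "matpow A (Suc k) = A ** matpow A k"

definition cmatrix :: "real^'n^'m \<Rightarrow> complex^'n^'m" where
  "cmatrix = map_matrix complex_of_real"

definition adjoint_matrix :: "complex^'n^'m \<Rightarrow> complex^'m^'n" where
  "adjoint_matrix M = map_matrix cnj (transpose M)"

definition is_eigenvalue :: "complex^'n^'n \<Rightarrow> complex \<Rightarrow> bool" where
  "is_eigenvalue M z \<longleftrightarrow> (\<exists>v. v \<noteq> 0 \<and> M *v v = z *s v)"

definition hurwitz :: "real^'n^'n \<Rightarrow> bool" where
  "hurwitz A \<longleftrightarrow> (\<forall>z. is_eigenvalue (cmatrix A) z \<longrightarrow> Re z < 0)"

text \<open>Block matrices, indexed by sum types.\<close>

definition hcat :: "'a^'n^'r \<Rightarrow> 'a^'k^'r \<Rightarrow> 'a^('n + 'k)^'r" (infixr "\<parallel>" 62) where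
  "M \<parallel> N = (\<chi> i j. case j of Inl a \<Rightarrow> M $ i $ a | Inr b \<Rightarrow> N $ i $ b)"

definition vcat :: "'a^'n^'r \<Rightarrow> 'a^'n^'s \<Rightarrow> 'a^'n^('r + 's)" (infixr "\<sslash>" 61) where
  "M \<sslash> N = (\<chi> i. case i of Inl a \<Rightarrow> M $ a | Inr b \<Rightarrow> N $ b)"

definition pos_definite :: "real^'n^'n \<Rightarrow> bool" where
  "pos_definite M \<longleftrightarrow> transpose M = M \<and> (\<forall>z. z \<noteq> 0 \<longrightarrow> z \<bullet> (M *v z) > 0)"

definition neg_definite :: "real^'n^'n \<Rightarrow> bool" where
  "neg_definite M \<longleftrightarrow> transpose M = M \<and> (\<forall>z. z \<noteq> 0 \<longrightarrow> z \<bullet> (M *v z) < 0)"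

definition relative_degree :: "real^'n^'n \<Rightarrow> real^'m^'n \<Rightarrow> real^'n \<Rightarrow> nat \<Rightarrow> bool" where
  "relative_degree A B c r \<longleftrightarrow>
     r \<ge> 1 \<and> c v* (matpow A (r - 1) ** B) \<noteq> 0 \<and> (\<forall>k < r - 1. c v* (matpow A k ** B) = 0)"

text \<open>\<open>Phi A a r\<close> is the product of the matrices \<open>A + a\<^sub>l I\<close> for \<open>l = 1, \<dots>, r\<close>.\<close>

definition Phi :: "real^'n^'n \<Rightarrow> (nat \<Rightarrow> real) \<Rightarrow> nat \<Rightarrow> real^'n^'n" where
  "Phi A a r = foldr (\<lambda>l M. (A + mat (a l)) ** M) [1..<Suc r] (mat 1)"

definition hocbf_constraint ::
  "real^'n^'n \<Rightarrow> real^'m^'n \<Rightarrow> real^'n \<Rightarrow> real \<Rightarrow> nat \<Rightarrow> (nat \<Rightarrow> real) \<Rightarrow> real^'n \<Rightarrow> real^'m \<Rightarrow> bool" where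
  "hocbf_constraint A B c d r a x u \<longleftrightarrow>
     (c v* Phi A a r) \<bullet> x + (c v* (matpow A (r - 1) ** B)) \<bullet> u + (\<Prod>j=1..r. a j) * d \<ge> 0"

definition safe_stabilizing_gains ::
  "real^'n^'n \<Rightarrow> real^'m^'n \<Rightarrow> nat \<Rightarrow> (nat \<Rightarrow> real^'n) \<Rightarrow> (nat \<Rightarrow> real) \<Rightarrow> (nat \<Rightarrow> nat) \<Rightarrow>
     (nat \<Rightarrow> nat \<Rightarrow> real) \<Rightarrow> (real^'n^'m) set" where
  "safe_stabilizing_gains A B pbar c d r \<alpha> =
     {K. hurwitz (A - B ** K) \<and>
         (\<forall>x. \<forall>i\<in>{1..pbar}. hocbf_constraint A B (c i) (d i) (r i) (\<alpha> i) x (- (K *v x)))}"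

definition singular_values :: "complex^'n^'m \<Rightarrow> real set" where
  "singular_values M = {s. s \<ge> 0 \<and> is_eigenvalue (adjoint_matrix M ** M) (of_real (s\<^sup>2))}"

definition max_singular_value :: "complex^'n^'m \<Rightarrow> real" where
  "max_singular_value M = Max (singular_values M)"

definition input_sensitivity ::
  "real^'n^'n \<Rightarrow> real^'m^'n \<Rightarrow> real^'n^'m \<Rightarrow> complex \<Rightarrow> complex^'m^'m" where
  "input_sensitivity A B K s =
     mat 1 - cmatrix K ** matrix_inv (mat s - cmatrix (A - B ** K)) ** cmatrix B"

text \<open>The supremum is taken in \<open>ereal\<close> so that it is meaningful without a boundedness proof.\<close>

definition hinf_norm :: "(complex \<Rightarrow> complex^'m^'m) \<Rightarrow> ereal" where
  "hinf_norm S = (SUP \<omega>::real. ereal (max_singular_value (S (\<i> * of_real \<omega>))))"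

text \<open>
  A matrix whose number of columns may be zero is given by the list of its columns. In
  \<open>stabilizable F G\<close> the list \<open>G\<close> holds the columns of the input matrix and \<open>H\<close> the rows of the
  gain; for \<open>G = []\<close> the product vanishes and the condition says that \<open>F\<close> is Hurwitz.
\<close>

definition columns_times_rows :: "(real^'n) list \<Rightarrow> (real^'k) list \<Rightarrow> real^'k^'n" where
  "columns_times_rows G H = (\<chi> i j. \<Sum>k<length G. G ! k $ i * H ! k $ j)"

definition stabilizable :: "real^'n^'n \<Rightarrow> (real^'n) list \<Rightarrow> bool" where
  "stabilizable F G \<longleftrightarrow> (\<exists>H. length H = length G \<and> hurwitz (F - columns_times_rows G H))"

definition basis_of_kernel :: "(real^'m) list \<Rightarrow> real^'m^'p \<Rightarrow> bool" where
  "basis_of_kernel vs M \<longleftrightarrow>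
     distinct vs \<and> independent (set vs) \<and> span (set vs) = {v. M *v v = 0}"

definition sensitivity_lmi ::
  "real^'n^'n \<Rightarrow> real^'m^'n \<Rightarrow> real \<Rightarrow> real^'n^'n \<Rightarrow> real^'n^'m \<Rightarrow>
     real^('n + 'm + 'm)^('n + 'm + 'm)" where
  "sensitivity_lmi A B \<gamma> X Y =
     (A ** X + X ** transpose A - B ** Y - transpose Y ** transpose B
                  \<parallel> B            \<parallel> - transpose Y)
     \<sslash> (transpose B \<parallel> mat (- \<gamma>)    \<parallel> mat 1)
     \<sslash> (- Y         \<parallel> mat 1        \<parallel> mat (- \<gamma>))"

definition sensitivity_feasible ::
  "real^'n^'n \<Rightarrow> real^'m^'n \<Rightarrow> real^'p^'m \<Rightarrow> real^'n^'p \<Rightarrow> real \<Rightarrow> real^'n^'n \<Rightarrow> real^'n^'m \<Rightarrow> bool" where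
  "sensitivity_feasible A B L Ct \<gamma> X Y \<longleftrightarrow>
     pos_definite X \<and> neg_definite (sensitivity_lmi A B \<gamma> X Y) \<and> transpose L ** Y = Ct ** X"

end

theory Submission
  imports Defs
begin

text \<open>
A linear feedback \<open>u = - K x\<close> turns every constraint into the nonnegativity, for all \<open>x\<close>, of an affine
function with nonnegative constant term. That forces the linear part to vanish, so the constraint is
the equation \<open>l\<^sub>i\<^sup>T K = c\<^sub>i\<^sup>T \<Phi>\<^sub>i(A)\<close>. The first \<open>p\<close> equations read \<open>L\<^sup>T K = C\<close>; the matrix \<open>K\<^sub>0\<close> is
one solution of them, any solution agrees with \<open>K\<^sub>0\<close> on the span of the \<open>l\<^sub>i\<close>, and so the remaining
equations follow from those for \<open>K\<^sub>0\<close>. Hence the safe stabilizing gains are exactly the stabilizing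
solutions of \<open>L\<^sup>T K = C\<close>, and with \<open>Y = K X\<close> this linear equation becomes \<open>L\<^sup>T Y = C X\<close>.

What remains is the strict bounded real lemma for \<open>F = A - B K\<close>. Put \<open>P = \<gamma> X\<^sup>-\<^sup>1\<close> and \<open>\<xi> = X x\<close>.
Completing the square in the last block variable shows that the block inequality is equivalent to the
dissipation inequality
\<open>2 P\<xi> \<bullet> (F\<xi> + Bu) + |u - K\<xi>|\<^sup>2 - \<gamma>\<^sup>2 |u|\<^sup>2 < 0\<close> for \<open>(\<xi>, u) \<noteq> 0\<close>.
On a sinusoidal trajectory, \<open>i\<omega> f = F f + B w\<close>, the term with \<open>P\<close> averages to zero, and \<open>w - K f\<close>
is the sensitivity applied to \<open>w\<close>. So the dissipation inequality bounds every singular value on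
the imaginary axis, and a compactness argument makes the bound uniform
(\<open>lmi_imp_sensitivity_bound\<close>).

For the converse (\<open>sensitivity_bound_imp_lmi\<close>) a matrix \<open>P\<close> has to be produced from the frequency
response; this is the lemma of Kalman, Yakubovich and Popov, proved here by duality. If no \<open>P\<close> exists,
a separating hyperplane gives a positive semidefinite \<open>W \<noteq> 0\<close> with
\<open>M\<^sub>2 W M\<^sub>1\<^sup>T + M\<^sub>1 W M\<^sub>2\<^sup>T = 0\<close>, where \<open>M\<^sub>1 = (I 0)\<close> and \<open>M\<^sub>2 = (F B)\<close>. Over the complex numbers such a \<open>W\<close>
is a sum of matrices \<open>z z\<^sup>*\<close> with \<open>M\<^sub>1 z = 0\<close> or \<open>M\<^sub>2 z = i\<omega> M\<^sub>1 z\<close>, that is, of sinusoidal trajectories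
and of one limit case of infinite frequency, and on each of them the frequency bound (respectively
\<open>\<gamma> > 1\<close>) gives the wrong sign (\<open>balanced_psd_inner_neg\<close>). Finally \<open>P\<close> is positive definite because \<open>F\<close>
is Hurwitz; this is Lyapunov's theorem, which is deduced from the same duality by letting
\<open>F - t I\<close> run from large \<open>t\<close> to \<open>t = 0\<close> (\<open>hurwitz_imp_lyapunov\<close>).
\<close>

section \<open>Quadratic forms on Euclidean spaces\<close>

text \<open>
The form at \<open>x + s h(x)\<close> is \<open>2 s |h x|\<^sup>2 + O(s\<^sup>2)\<close>, which would be negative for small negative \<open>s\<close> if
\<open>h x\<close> did not vanish.
\<close>

lemma psd_form_zero_imp_kernel:
  fixes h :: "'a::real_inner \<Rightarrow> 'a"
  assumes h: "linear h" and sym: "\<And>x y. x \<bullet> h y = h x \<bullet> y"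
    and psd: "\<And>x. 0 \<le> x \<bullet> h x" and zero: "x \<bullet> h x = 0"
  shows "h x = 0"
proof -
  define a c s where "a = h x \<bullet> h x" and "c = h x \<bullet> h (h x)" and "s = - (a / (c + 1))"
  have c: "c \<ge> 0" unfolding c_def by (rule psd)
  have "(x + s *\<^sub>R h x) \<bullet> h (x + s *\<^sub>R h x) = 2 * s * a + s\<^sup>2 * c"
    using zero sym[of x "h x"]
    by (simp add: linear_add[OF h] linear_scale[OF h] inner_simps a_def c_def power2_eq_square
        inner_commute algebra_simps)
  then have "0 \<le> 2 * s * a + s\<^sup>2 * c" using psd by metis
  also have "2 * s * a + s\<^sup>2 * c = s * (2 * a + s * c)" by (simp add: power2_eq_square algebra_simps)
  finally have le: "0 \<le> s * (2 * a + s * c)" .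
  have "a \<ge> 0" by (simp add: a_def)
  moreover have "\<not> a > 0"
  proof
    assume "a > 0"
    then have "s < 0" using c by (simp add: s_def)
    have "a * (c / (c + 1)) \<le> a * 1" using \<open>a > 0\<close> c by (intro mult_left_mono) auto
    then have "2 * a + s * c > 0" using \<open>a > 0\<close> by (simp add: s_def)
    with \<open>s < 0\<close> have "s * (2 * a + s * c) < 0" by (rule mult_neg_pos)
    with le show False by simp
  qed
  ultimately have "a = 0" by simp
  then show ?thesis by (simp add: a_def)
qed

lemma compact_form_bound:
  fixes h :: "'a::euclidean_space \<Rightarrow> 'a"
  assumes h: "linear h" and neg: "\<And>x. x \<noteq> 0 \<Longrightarrow> x \<bullet> h x < 0"
  obtains \<epsilon> where "\<epsilon> > 0" and "\<And>x. x \<bullet> h x \<le> - \<epsilon> * (x \<bullet> x)"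
proof -
  have ne: "sphere (0::'a) 1 \<noteq> {}" by simp
  have "continuous_on (sphere 0 1) (\<lambda>x. x \<bullet> h x)"
    using h by (intro continuous_intros linear_continuous_on) (simp add: linear_conv_bounded_linear)
  from continuous_attains_sup[OF compact_sphere ne this]
  obtain x0 where x0: "x0 \<in> sphere 0 1" and max: "\<And>x. x \<in> sphere 0 1 \<Longrightarrow> x \<bullet> h x \<le> x0 \<bullet> h x0"
    by blast
  have "x0 \<noteq> 0" using x0 by auto
  show ?thesis
  proof (rule that[of "- (x0 \<bullet> h x0)"])
    show "- (x0 \<bullet> h x0) > 0" using neg[OF \<open>x0 \<noteq> 0\<close>] by simp
    fix x
    show "x \<bullet> h x \<le> - (- (x0 \<bullet> h x0)) * (x \<bullet> x)"
    proof (cases "x = 0")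
      case False
      have "(x /\<^sub>R norm x) \<bullet> h (x /\<^sub>R norm x) \<le> x0 \<bullet> h x0" using False by (intro max) simp
      then have "(x \<bullet> h x) / (norm x)\<^sup>2 \<le> x0 \<bullet> h x0"
        by (simp add: linear_scale[OF h] power2_eq_square field_simps)
      then show ?thesis using False
        by (simp add: pos_divide_le_eq power2_norm_eq_inner)
    qed simp
  qed
qed

text \<open>
A generalized eigenvector for the largest generalized eigenvalue of a pair of symmetric operators, of
which the second is only semidefinite. On the orthogonal complement of its kernel the Rayleigh quotient
attains its maximum \<open>\<mu>\<close>; then \<open>\<mu> g - f\<close> is positive semidefinite on the whole space, since \<open>f\<close> and \<open>g\<close> both
vanish on the kernel of \<open>g\<close>, and its form is zero at the maximizer. All eigenvectors needed below come
from this variational argument.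
\<close>

lemma rayleigh_maximizer:
  fixes f g :: "'a::euclidean_space \<Rightarrow> 'a"
  assumes f: "linear f" and g: "linear g"
    and fs: "\<And>x y. x \<bullet> f y = f x \<bullet> y" and gs: "\<And>x y. x \<bullet> g y = g x \<bullet> y"
    and psd: "\<And>x. 0 \<le> x \<bullet> g x" and ker: "\<And>x. g x = 0 \<Longrightarrow> f x = 0"
    and nz: "g x1 \<noteq> 0"
  obtains x \<mu> where "g x \<noteq> 0" and "f x = \<mu> *\<^sub>R g x" and "\<And>v. v \<bullet> f v \<le> \<mu> * (v \<bullet> g v)"
proof -
  define S where "S = {x. g x = 0}"
  have S: "subspace S" unfolding S_def using g by (rule linear_subspace_kernel)
  define T where "T = {x. \<forall>w\<in>S. x \<bullet> w = 0}"
  have Tdecomp: "\<exists>y z. y \<in> S \<and> z \<in> T \<and> x = y + z" for x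
  proof -
    obtain y z where "y \<in> span S" and z: "\<And>w. w \<in> span S \<Longrightarrow> orthogonal z w" and "x = y + z"
      using orthogonal_subspace_decomp_exists[of S x] by blast
    moreover have "z \<in> T" unfolding T_def using z span_base by (auto simp: orthogonal_def)
    moreover have "span S = S" using S by (simp add: span_eq_iff)
    ultimately show ?thesis by blast
  qed
  have closedT: "closed T"
  proof -
    have "T = (\<Inter>w\<in>S. {x. x \<bullet> w = 0})" unfolding T_def by auto
    moreover have "closed {x. x \<bullet> w = 0}" for w :: 'a
      by (intro closed_Collect_eq continuous_intros)
    ultimately show ?thesis by auto
  qed
  have comp: "compact (sphere 0 1 \<inter> T)" using closedT by (intro compact_Int_closed) auto
  have TS: "x = 0" if "x \<in> T" "x \<in> S" for x using that unfolding T_def by fastforce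
  have cf: "continuous_on A f" "continuous_on A g" for A
    using f g by (auto intro!: linear_continuous_on simp: linear_conv_bounded_linear)
  have gpos: "x \<bullet> g x > 0" if "g x \<noteq> 0" for x
  proof -
    have "x \<bullet> g x \<noteq> 0" using psd_form_zero_imp_kernel[OF g gs psd] that by blast
    with psd[of x] show ?thesis by linarith
  qed
  obtain y1 z1 where "y1 \<in> S" "z1 \<in> T" "x1 = y1 + z1" using Tdecomp by blast
  with nz have "z1 \<noteq> 0" by (auto simp: S_def)
  have "z1 /\<^sub>R norm z1 \<in> sphere 0 1 \<inter> T" using \<open>z1 \<noteq> 0\<close> \<open>z1 \<in> T\<close> by (auto simp: T_def)
  then have ne: "sphere 0 1 \<inter> T \<noteq> {}" by blast
  have "continuous_on (sphere 0 1 \<inter> T) (\<lambda>x. (x \<bullet> f x) / (x \<bullet> g x))"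
  proof (intro continuous_intros cf ballI)
    fix x assume "x \<in> sphere 0 1 \<inter> T"
    then have "g x \<noteq> 0" using TS[of x] by (auto simp: S_def)
    then show "x \<bullet> g x \<noteq> 0" using gpos by force
  qed
  from continuous_attains_sup[OF comp ne this]
  obtain x where x: "x \<in> sphere 0 1 \<inter> T"
    and max: "\<And>v. v \<in> sphere 0 1 \<inter> T \<Longrightarrow> (v \<bullet> f v) / (v \<bullet> g v) \<le> (x \<bullet> f x) / (x \<bullet> g x)"
    by blast
  define \<mu> where "\<mu> = (x \<bullet> f x) / (x \<bullet> g x)"
  have gx: "g x \<noteq> 0" using TS[of x] x by (auto simp: S_def)
  have bound: "v \<bullet> f v \<le> \<mu> * (v \<bullet> g v)" for v
  proof -
    obtain y z where yz: "y \<in> S" "z \<in> T" "v = y + z" using Tdecomp by blast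
    have y0: "g y = 0" "f y = 0" using yz ker by (auto simp: S_def)
    have e1: "v \<bullet> f v = z \<bullet> f z" using y0 fs[of y z]
      by (simp add: yz linear_add[OF f] inner_simps)
    have e2: "v \<bullet> g v = z \<bullet> g z" using y0 gs[of y z]
      by (simp add: yz linear_add[OF g] inner_simps)
    show ?thesis
    proof (cases "z = 0")
      case True then show ?thesis using e1 e2 by (simp add: linear_0[OF f])
    next
      case False
      have "g z \<noteq> 0" using TS[of z] yz False by (auto simp: S_def)
      have "z /\<^sub>R norm z \<in> sphere 0 1 \<inter> T" using False yz by (auto simp: T_def)
      from max[OF this] have "(z \<bullet> f z) / (z \<bullet> g z) \<le> \<mu>" using False
        by (simp add: linear_scale[OF f] linear_scale[OF g] \<mu>_def)
      then show ?thesis using gpos[OF \<open>g z \<noteq> 0\<close>] e1 e2 by (simp add: pos_divide_le_eq)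
    qed
  qed
  let ?h = "\<lambda>v. \<mu> *\<^sub>R g v - f v"
  have "?h x = 0"
  proof (rule psd_form_zero_imp_kernel[where h = ?h])
    show "linear ?h"
      by (rule linearI) (simp_all add: linear_add[OF f] linear_add[OF g] linear_scale[OF f]
          linear_scale[OF g] algebra_simps)
    show "a \<bullet> ?h b = ?h a \<bullet> b" for a b using fs[of a b] gs[of a b] by (simp add: inner_simps)
    show "0 \<le> a \<bullet> ?h a" for a using bound[of a] by (simp add: inner_simps)
    show "x \<bullet> ?h x = 0" using gpos[OF gx] by (simp add: inner_simps \<mu>_def)
  qed
  then have "f x = \<mu> *\<^sub>R g x" by simp
  from that[OF gx this bound] show ?thesis .
qed

section \<open>Complex inner products and rank-one matrices\<close>

text \<open>
The inner product \<open>\<bullet>\<close> on complex vectors is real-valued; it is the real part of the Hermitian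
product. Orthogonality and definiteness are expressed with \<open>\<bullet>\<close>, and the Hermitian product serves only where
phases matter.
\<close>

definition cinner :: "complex^'n \<Rightarrow> complex^'n \<Rightarrow> complex" where
  "cinner x y = (\<Sum>i\<in>UNIV. cnj (x $ i) * y $ i)"

definition outer :: "complex^'n \<Rightarrow> complex^'m \<Rightarrow> complex^'m^'n" where
  "outer x y = (\<chi> i j. x $ i * cnj (y $ j))"

lemma Re_cinner: "Re (cinner x y) = x \<bullet> y"
  by (simp add: cinner_def inner_vec_def inner_complex_def)

lemma cinner_commute: "cinner y x = cnj (cinner x y)"
  by (simp add: cinner_def mult.commute)

lemma cinner_simps:
  "cinner x (y + z) = cinner x y + cinner x z" "cinner (x + y) z = cinner x z + cinner y z"
  "cinner x (y - z) = cinner x y - cinner x z" "cinner (x - y) z = cinner x z - cinner y z"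
  "cinner x (a *s y) = a * cinner x y" "cinner (a *s x) y = cnj a * cinner x y"
  "cinner x 0 = 0" "cinner 0 x = 0"
  by (simp_all add: cinner_def sum.distrib sum_subtractf sum_distrib_left algebra_simps)

lemma cinner_adjoint: "cinner x (M *v y) = cinner (adjoint_matrix M *v x) y"
proof -
  have "cinner x (M *v y) = (\<Sum>i\<in>UNIV. \<Sum>j\<in>UNIV. cnj (x $ i) * (M $ i $ j * y $ j))"
    by (simp add: cinner_def matrix_vector_mult_def sum_distrib_left)
  also have "\<dots> = (\<Sum>j\<in>UNIV. \<Sum>i\<in>UNIV. cnj (x $ i) * (M $ i $ j * y $ j))"
    by (rule sum.swap)
  also have "\<dots> = cinner (adjoint_matrix M *v x) y"
    by (simp add: cinner_def matrix_vector_mult_def adjoint_matrix_def transpose_def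
        sum_distrib_left sum_distrib_right mult_ac)
  finally show ?thesis .
qed

lemma inner_adjoint: "x \<bullet> (M *v y) = (adjoint_matrix M *v x) \<bullet> y" for M :: "complex^'n^'m"
  by (metis Re_cinner cinner_adjoint)

lemma adjoint_adjoint [simp]: "adjoint_matrix (adjoint_matrix M) = M"
  by (simp add: adjoint_matrix_def transpose_def vec_eq_iff)

lemma adjoint_mult: "adjoint_matrix (M ** N) = adjoint_matrix N ** adjoint_matrix M"
  by (simp add: adjoint_matrix_def transpose_def matrix_matrix_mult_def vec_eq_iff mult.commute)

lemma adjoint_outer: "adjoint_matrix (outer x y) = outer y x"
  by (simp add: adjoint_matrix_def transpose_def outer_def vec_eq_iff mult.commute)

lemma adjoint_diff: "adjoint_matrix (M - N) = adjoint_matrix M - adjoint_matrix N"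
  by (simp add: adjoint_matrix_def transpose_def vec_eq_iff)

lemma adjoint_scaleR: "adjoint_matrix (t *\<^sub>R M) = t *\<^sub>R adjoint_matrix M"
  by (simp add: adjoint_matrix_def transpose_def vec_eq_iff)

lemma outer_mult_vec: "outer x y *v v = cinner y v *s x"
  by (simp add: outer_def cinner_def matrix_vector_mult_def vec_eq_iff sum_distrib_left
      sum_distrib_right mult_ac)

lemma mult_outer: "M ** outer x y = outer (M *v x) y"
  by (simp add: outer_def matrix_matrix_mult_def matrix_vector_mult_def vec_eq_iff
      sum_distrib_left sum_distrib_right mult_ac)

lemma outer_mult_adjoint: "outer x y ** adjoint_matrix M = outer x (M *v y)"
  by (simp add: outer_def matrix_matrix_mult_def matrix_vector_mult_def vec_eq_iff
      sum_distrib_left mult_ac adjoint_matrix_def transpose_def)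

lemma inner_outer: "\<Theta> \<bullet> outer x y = (\<Theta> *v y) \<bullet> x"
proof -
  have "\<Theta> \<bullet> outer x y = (\<Sum>i\<in>UNIV. \<Sum>j\<in>UNIV. Re (cnj (\<Theta> $ i $ j) * (x $ i * cnj (y $ j))))"
    by (simp add: inner_vec_def inner_complex_def outer_def)
  also have "\<dots> = (\<Sum>i\<in>UNIV. Re (cnj (\<Sum>j\<in>UNIV. \<Theta> $ i $ j * y $ j) * x $ i))"
    by (simp add: sum_distrib_left sum_distrib_right algebra_simps)
  also have "\<dots> = (\<Theta> *v y) \<bullet> x"
  proof -
    have "Re (cnj a * b) = a \<bullet> b" for a b by (simp add: inner_complex_def)
    then show ?thesis
      unfolding inner_vec_def[of "\<Theta> *v y"] by (simp only: matrix_vector_mult_def vec_lambda_beta)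
  qed
  finally show ?thesis .
qed

lemma scaleR_mult_vec: "(t *\<^sub>R M) *v x = t *\<^sub>R (M *v x)" for M :: "complex^'n^'m"
  by (simp add: matrix_vector_mult_def vec_eq_iff scaleR_sum_right)

lemma scaleR_matrix_mult:
  "(t *\<^sub>R M) ** N = t *\<^sub>R (M ** N)" "M ** (t *\<^sub>R N) = t *\<^sub>R (M ** N)"
  for M :: "complex^'n^'m"
  by (simp_all add: matrix_matrix_mult_def vec_eq_iff scaleR_sum_right)

lemma matrix_mult_diff:
  "(M - M') ** N = M ** N - M' ** N" "M ** (N - N') = M ** N - M ** N'"
  for M :: "'a::ring_1^'n^'m"
  by (simp_all add: matrix_matrix_mult_def vec_eq_iff sum_subtractf algebra_simps)

lemma scaleR_eq_smult: "t *\<^sub>R x = complex_of_real t *s x"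
  by (simp add: vec_eq_iff complex_eq_iff)

lemma neg_mult_vec: "(- M) *v x = - (M *v x)" for M :: "'a::ring_1^'n^'m"
  by (simp add: matrix_vector_mult_def vec_eq_iff sum_negf)

section \<open>Positive semidefinite matrices balanced between two maps\<close>

lemma hermitian_psd_kernel:
  fixes W :: "complex^'k^'k"
  assumes "adjoint_matrix W = W" and "\<And>x. 0 \<le> x \<bullet> (W *v x)" and "x \<bullet> (W *v x) = 0"
  shows "W *v x = 0"
  using assms inner_adjoint[of _ W] by (intro psd_form_zero_imp_kernel[of "(*v) W"]) auto

text \<open>
The balance condition says that \<open>N = M\<^sub>2 W M\<^sub>1\<^sup>*\<close> is skew-Hermitian. So \<open>i N\<close> and \<open>G = M\<^sub>1 W M\<^sub>1\<^sup>*\<close> are both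
Hermitian, \<open>G\<close> is semidefinite with kernel inside that of \<open>N\<close>, and a maximizer \<open>x\<close> of their Rayleigh
quotient satisfies \<open>i N x = \<mu> G x\<close> with \<open>\<mu>\<close> real. The vector \<open>W M\<^sub>1\<^sup>* x\<close> is the one sought. If \<open>G = 0\<close>,
then \<open>M\<^sub>1 W = 0\<close> and any vector in the range of \<open>W\<close> will do.
\<close>

lemma pencil_eigenvector:
  fixes W :: "complex^'k^'k" and M1 M2 :: "complex^'k^'n"
  assumes herm: "adjoint_matrix W = W" and psd: "\<And>x. 0 \<le> x \<bullet> (W *v x)" and "W \<noteq> 0"
    and bal: "M2 ** W ** adjoint_matrix M1 + M1 ** W ** adjoint_matrix M2 = 0"
  obtains y where "W *v y \<noteq> 0"
    and "M1 *v (W *v y) = 0 \<or> (\<exists>\<omega>::real. M2 *v (W *v y) = (\<i> * of_real \<omega>) *s (M1 *v (W *v y)))"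
proof -
  define G N where "G = M1 ** W ** adjoint_matrix M1" and "N = M2 ** W ** adjoint_matrix M1"
  have G_adj: "adjoint_matrix G = G"
    by (simp add: G_def adjoint_mult herm matrix_mul_assoc)
  have "adjoint_matrix N = M1 ** W ** adjoint_matrix M2"
    by (simp add: N_def adjoint_mult herm matrix_mul_assoc)
  with bal have N_adj: "adjoint_matrix N = - N"
    by (metis N_def add_eq_0_iff)
  have Gform: "x \<bullet> (G *v x) = (adjoint_matrix M1 *v x) \<bullet> (W *v (adjoint_matrix M1 *v x))" for x
    by (simp add: G_def inner_adjoint[of _ M1] flip: matrix_vector_mul_assoc)
  have Gpsd: "0 \<le> x \<bullet> (G *v x)" for x unfolding Gform by (rule psd)
  have Gker: "W *v (adjoint_matrix M1 *v x) = 0" if "G *v x = 0" for x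
    using hermitian_psd_kernel[OF herm psd] Gform[of x] that by simp
  show ?thesis
  proof (cases "G = 0")
    case True
    obtain y where y: "W *v y \<noteq> 0" using \<open>W \<noteq> 0\<close> by (metis matrix_eq matrix_vector_mult_0)
    have "W ** adjoint_matrix M1 = 0"
      using Gker True by (simp add: matrix_eq flip: matrix_vector_mul_assoc)
    then have "adjoint_matrix (W ** adjoint_matrix M1) = 0"
      by (simp add: adjoint_matrix_def transpose_def vec_eq_iff)
    then have "M1 *v (W *v y) = 0"
      by (simp add: adjoint_mult herm matrix_vector_mul_assoc)
    with y that show ?thesis by blast
  next
    case False
    then obtain x1 where x1: "G *v x1 \<noteq> 0" by (metis matrix_eq matrix_vector_mult_0)
    let ?f = "\<lambda>x. \<i> *s (N *v x)"
    have f_sym: "x \<bullet> ?f y = ?f x \<bullet> y" for x y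
    proof -
      have "cinner x (?f y) = \<i> * cinner (adjoint_matrix N *v x) y"
        by (simp add: cinner_simps cinner_adjoint)
      also have "\<dots> = \<i> * cinner (- (N *v x)) y"
        by (simp add: N_adj neg_mult_vec)
      also have "\<dots> = cinner (?f x) y"
        using cinner_simps(4)[of 0 "N *v x" y] by (simp add: cinner_simps)
      finally show ?thesis by (metis Re_cinner)
    qed
    obtain x \<mu> where x: "G *v x \<noteq> 0" "?f x = \<mu> *\<^sub>R (G *v x)"
    proof (rule rayleigh_maximizer[of ?f "(*v) G" x1])
      show "linear ?f"
        by (rule linearI) (simp_all add: matrix_vector_right_distrib scaleR_eq_smult vector_add_ldistrib
            vector_scalar_commute vector_smult_assoc mult.commute)
      show "?f x = 0" if "G *v x = 0" for x
        using Gker[OF that] by (simp add: N_def flip: matrix_vector_mul_assoc)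
      show "x \<bullet> (G *v y) = (G *v x) \<bullet> y" for x y
        using inner_adjoint[of x G y] by (simp add: G_adj)
    qed (use x1 Gpsd f_sym in auto)
    let ?y = "adjoint_matrix M1 *v x"
    have M1y: "M1 *v (W *v ?y) = G *v x"
      by (simp add: G_def matrix_vector_mul_assoc matrix_mul_assoc)
    have "M2 *v (W *v ?y) = N *v x"
      by (simp add: N_def matrix_vector_mul_assoc matrix_mul_assoc)
    also have "\<dots> = (- \<i>) *s ?f x" by (simp add: vector_smult_assoc)
    also have "\<dots> = (\<i> * of_real (- \<mu>)) *s (G *v x)"
      by (simp add: x(2) scaleR_eq_smult vector_smult_assoc)
    finally have "M2 *v (W *v ?y) = (\<i> * of_real (- \<mu>)) *s (M1 *v (W *v ?y))"
      by (simp add: M1y)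
    moreover have "W *v ?y \<noteq> 0" using x(1) M1y by auto
    ultimately show ?thesis using that by blast
  qed
qed

text \<open>
Subtracting \<open>t z z\<^sup>*\<close> for \<open>z = W y\<close> in the range of \<open>W\<close>: the chosen \<open>t\<close> is the largest for which
the difference stays positive semidefinite, by the Cauchy-Schwarz inequality for the form of \<open>W\<close>, and at this
value \<open>y\<close> enters the kernel.
\<close>

lemma deflate_psd:
  fixes W :: "complex^'k^'k"
  assumes herm: "adjoint_matrix W = W" and psd: "\<And>x. 0 \<le> x \<bullet> (W *v x)" and z: "W *v y \<noteq> 0"
  defines "t \<equiv> inverse (y \<bullet> (W *v y))"
  defines "W' \<equiv> W - t *\<^sub>R outer (W *v y) (W *v y)"
  shows "t > 0" and "adjoint_matrix W' = W'" and "0 \<le> x \<bullet> (W' *v x)"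
    and "dim {x. W *v x = 0} < dim {x. W' *v x = 0}"
proof -
  define q where "q = y \<bullet> (W *v y)"
  have "q \<noteq> 0" unfolding q_def using hermitian_psd_kernel[OF herm psd] z by blast
  then have q: "q > 0" using psd[of y] by (simp add: q_def)
  have t: "t = inverse q" by (simp add: t_def q_def)
  show "t > 0" using q by (simp add: t)
  show "adjoint_matrix W' = W'"
    by (simp add: W'_def adjoint_diff adjoint_scaleR adjoint_outer herm)
  have Wyy: "cinner (W *v y) y = complex_of_real q" 
  proof -
    have "cinner (W *v y) y = cinner y (W *v y)" using cinner_adjoint[of y W y] herm by simp
    then have "cnj (cinner (W *v y) y) = cinner (W *v y) y" using cinner_commute by metis
    moreover have "Re (cinner (W *v y) y) = q" by (simp add: Re_cinner q_def inner_commute)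
    ultimately show ?thesis by (simp add: complex_eq_iff)
  qed
  have W'v: "W' *v v = W *v v - (complex_of_real t * cinner (W *v y) v) *s (W *v y)" for v
    by (simp add: W'_def matrix_vector_mult_diff_rdistrib scaleR_mult_vec outer_mult_vec
        scaleR_eq_smult vector_smult_assoc)
  show "0 \<le> x \<bullet> (W' *v x)"
  proof -
    define b where "b = cinner (W *v y) x"
    (* The form of W at the component of x that is W-orthogonal to y is the form of the difference at x. *)
    let ?v = "x - (complex_of_real t * b) *s y"
    have xWy: "cinner x (W *v y) = cnj b" by (simp add: b_def flip: cinner_commute)
    have yWx: "cinner y (W *v x) = b" using cinner_adjoint[of y W x] herm by (simp add: b_def)
    have yWy: "cinner y (W *v y) = complex_of_real q"
      using cinner_adjoint[of y W y] herm Wyy by simp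
    have "cinner ?v (W *v ?v) = cinner x (W *v x) - complex_of_real t * b * cnj b
        - complex_of_real t * cnj b * b + complex_of_real (t * t * q) * b * cnj b"
      by (simp add: matrix_vector_mult_diff_distrib vector_scalar_commute cinner_simps xWy yWx yWy
          algebra_simps)
    also have "t * t * q = t" using \<open>q \<noteq> 0\<close> by (simp add: t)
    finally have "cinner ?v (W *v ?v) = cinner x (W' *v x)"
      by (simp add: W'v cinner_simps xWy b_def)
    then have "x \<bullet> (W' *v x) = ?v \<bullet> (W *v ?v)" by (metis Re_cinner)
    then show ?thesis using psd by simp
  qed
  have sub: "subspace {x. W *v x = 0}" "subspace {x. W' *v x = 0}"
    by (auto intro!: linear_subspace_kernel)
  have "W' *v y = 0" using \<open>q \<noteq> 0\<close> by (simp add: W'v Wyy t flip: of_real_mult)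
  moreover have "W' *v v = 0" if "W *v v = 0" for v
    using that cinner_adjoint[of y W v] herm by (simp add: W'v cinner_simps)
  ultimately have "{x. W *v x = 0} \<subset> {x. W' *v x = 0}" using z by blast
  then show "dim {x. W *v x = 0} < dim {x. W' *v x = 0}"
    using sub by (metis dim_psubset span_eq_iff)
qed

text \<open>
Induction on the rank of \<open>W\<close>, measured by the codimension of its kernel. The vector \<open>z\<close> found in
\<open>pencil_eigenvector\<close> is split off. The matrix \<open>z z\<^sup>*\<close> is balanced, because \<open>M\<^sub>2 z\<close> is a purely
imaginary multiple of \<open>M\<^sub>1 z\<close> or \<open>M\<^sub>1 z = 0\<close>, so the remainder is balanced too and has smaller rank,
while \<open>\<Theta> \<bullet> z z\<^sup>* = z \<bullet> \<Theta> z < 0\<close>.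
\<close>

lemma balanced_psd_inner_neg:
  fixes W \<Theta> :: "complex^'k^'k" and M1 M2 :: "complex^'k^'n"
  assumes freq: "\<And>z. z \<noteq> 0 \<Longrightarrow>
      M1 *v z = 0 \<or> (\<exists>\<omega>::real. M2 *v z = (\<i> * of_real \<omega>) *s (M1 *v z)) \<Longrightarrow> z \<bullet> (\<Theta> *v z) < 0"
    and "adjoint_matrix W = W" and "\<And>x. 0 \<le> x \<bullet> (W *v x)" and "W \<noteq> 0"
    and "M2 ** W ** adjoint_matrix M1 + M1 ** W ** adjoint_matrix M2 = 0"
  shows "\<Theta> \<bullet> W < 0"
  using assms(2-)
proof (induction "DIM(complex^'k) - dim {x. W *v x = 0}" arbitrary: W rule: less_induct)
  case less
  note herm = less.prems(1) and psd = less.prems(2) and bal = less.prems(4)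
  obtain y where y: "W *v y \<noteq> 0"
    and pencil: "M1 *v (W *v y) = 0 \<or>
      (\<exists>\<omega>::real. M2 *v (W *v y) = (\<i> * of_real \<omega>) *s (M1 *v (W *v y)))"
    using pencil_eigenvector[OF herm psd \<open>W \<noteq> 0\<close> bal] .
  define z t where "z = W *v y" and "t = inverse (y \<bullet> (W *v y))"
  define W' where "W' = W - t *\<^sub>R outer z z"
  have defl: "t > 0" "adjoint_matrix W' = W'" "\<And>x. 0 \<le> x \<bullet> (W' *v x)"
    "dim {x. W *v x = 0} < dim {x. W' *v x = 0}"
    using deflate_psd[OF herm psd y] unfolding t_def z_def W'_def by auto
  have neg: "\<Theta> \<bullet> outer z z < 0"
    using freq[of z] y pencil by (simp add: inner_outer inner_commute z_def)
  have W: "\<Theta> \<bullet> W = \<Theta> \<bullet> W' + t * (\<Theta> \<bullet> outer z z)"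
    by (simp add: W'_def inner_simps)
  have outer_bal: "outer (M2 *v z) (M1 *v z) + outer (M1 *v z) (M2 *v z) = 0"
  proof (cases "M1 *v z = 0")
    case True then show ?thesis by (simp add: outer_def vec_eq_iff)
  next
    case False
    then obtain \<omega> :: real where "M2 *v z = (\<i> * of_real \<omega>) *s (M1 *v z)"
      using pencil by (auto simp: z_def)
    then show ?thesis by (simp add: outer_def vec_eq_iff)
  qed
  have bal': "M2 ** W' ** adjoint_matrix M1 + M1 ** W' ** adjoint_matrix M2 = 0"
  proof -
    have "M2 ** W' ** adjoint_matrix M1 + M1 ** W' ** adjoint_matrix M2
        = (M2 ** W ** adjoint_matrix M1 + M1 ** W ** adjoint_matrix M2)
          - t *\<^sub>R (outer (M2 *v z) (M1 *v z) + outer (M1 *v z) (M2 *v z))"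
      by (simp add: W'_def matrix_mult_diff scaleR_matrix_mult mult_outer outer_mult_adjoint
          algebra_simps)
    then show ?thesis using bal outer_bal by simp
  qed
  have "\<Theta> \<bullet> W' \<le> 0"
  proof (cases "W' = 0")
    case False
    have "dim {x. W' *v x = 0} \<le> DIM(complex^'k)" by (rule dim_subset_UNIV)
    then have "DIM(complex^'k) - dim {x. W' *v x = 0} < DIM(complex^'k) - dim {x. W *v x = 0}"
      using defl(4) by linarith
    then show ?thesis using less.hyps[OF _ defl(2,3) False bal'] by simp
  qed simp
  moreover have "t * (\<Theta> \<bullet> outer z z) < 0" using defl(1) neg by (rule mult_pos_neg)
  ultimately show ?case using W by linarith
qed

section \<open>A theorem of the alternative for linear matrix inequalities\<close>

lemma inner_matrix_mult:
  fixes A :: "real^'n^'m" and B :: "real^'k^'m" and C :: "real^'n^'k"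
  shows "A \<bullet> (B ** C) = (transpose B ** A) \<bullet> C" and "A \<bullet> (B ** C) = (A ** transpose C) \<bullet> B"
proof -
  have eq: "A \<bullet> (B ** C) = (\<Sum>i\<in>UNIV. \<Sum>j\<in>UNIV. \<Sum>k\<in>UNIV. A $ i $ j * B $ i $ k * C $ k $ j)"
    by (simp add: inner_vec_def matrix_matrix_mult_def sum_distrib_left mult_ac)
  also have "\<dots> = (\<Sum>k\<in>UNIV. \<Sum>j\<in>UNIV. \<Sum>i\<in>UNIV. A $ i $ j * B $ i $ k * C $ k $ j)"
    by (subst sum.swap, subst sum.swap[of _ UNIV UNIV], intro sum.cong refl, subst sum.swap, rule refl)
  also have "\<dots> = (transpose B ** A) \<bullet> C"
    by (simp add: inner_vec_def matrix_matrix_mult_def transpose_def sum_distrib_left mult_ac)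
  finally show "A \<bullet> (B ** C) = (transpose B ** A) \<bullet> C" .
  have "(\<Sum>i\<in>UNIV. \<Sum>j\<in>UNIV. \<Sum>k\<in>UNIV. A $ i $ j * B $ i $ k * C $ k $ j)
      = (\<Sum>i\<in>UNIV. \<Sum>k\<in>UNIV. \<Sum>j\<in>UNIV. A $ i $ j * B $ i $ k * C $ k $ j)"
    by (intro sum.cong refl) (rule sum.swap)
  also have "\<dots> = (A ** transpose C) \<bullet> B"
    by (simp add: inner_vec_def matrix_matrix_mult_def transpose_def sum_distrib_left mult_ac)
  finally show "A \<bullet> (B ** C) = (A ** transpose C) \<bullet> B" using eq by simp
qed

lemma transpose_add: "transpose (M + N) = transpose M + transpose N"
  by (simp add: transpose_def vec_eq_iff)

lemma inner_transpose: "transpose A \<bullet> transpose B = A \<bullet> B" for A :: "real^'n^'m"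
  unfolding inner_vec_def transpose_def by (simp) (rule sum.swap)

lemma inner_mult_transpose: "x \<bullet> (transpose M *v y) = (M *v x) \<bullet> y" for M :: "real^'n^'m"
  by (metis dot_lmul_matrix inner_commute transpose_matrix_vector)

text \<open>
Separation of the affine space \<open>\<Theta> + S\<close> from the open convex cone of matrices with negative form. The
cone is taken in the space of all square matrices, where only the symmetric part of a matrix matters; that
\<open>S\<close> contains the skew-symmetric matrices makes the separating functional symmetric.
\<close>

lemma lmi_alternative:
  fixes \<Theta> :: "real^'k^'k"
  assumes S: "subspace S" and skew: "\<And>K. K - transpose K \<in> S"
    and infeasible: "\<not> (\<exists>N\<in>S. \<forall>z. z \<noteq> 0 \<longrightarrow> z \<bullet> ((\<Theta> + N) *v z) < 0)"
  obtains W where "W \<noteq> 0" and "transpose W = W" and "\<And>z. 0 \<le> z \<bullet> (W *v z)"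
    and "\<And>N. N \<in> S \<Longrightarrow> W \<bullet> N = 0" and "0 \<le> W \<bullet> \<Theta>"
proof -
  define C :: "(real^'k^'k) set" where "C = {N. \<forall>z. z \<noteq> 0 \<longrightarrow> z \<bullet> (N *v z) < 0}"
  have form_comb: "z \<bullet> ((u *\<^sub>R M + v *\<^sub>R N) *v z) = u * (z \<bullet> (M *v z)) + v * (z \<bullet> (N *v z))"
    for u v z and M N :: "real^'k^'k"
    by (simp add: matrix_vector_mult_add_rdistrib inner_simps flip: scaleR_matrix_vector_assoc)
  have "convex C"
  proof (rule convexI)
    fix M N :: "real^'k^'k" and u v :: real
    assume MN: "M \<in> C" "N \<in> C" and uv: "0 \<le> u" "0 \<le> v" "u + v = 1"
    show "u *\<^sub>R M + v *\<^sub>R N \<in> C" unfolding C_def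
    proof (intro CollectI allI impI)
      fix z :: "real^'k" assume "z \<noteq> 0"
      then have neg: "z \<bullet> (M *v z) < 0" "z \<bullet> (N *v z) < 0" using MN by (auto simp: C_def)
      show "z \<bullet> ((u *\<^sub>R M + v *\<^sub>R N) *v z) < 0"
        unfolding form_comb using neg uv
        by (cases "u = 0") (auto intro: add_neg_nonpos simp: mult_pos_neg mult_nonneg_nonpos)
    qed
  qed
  have shifted: "t *\<^sub>R (N - \<delta> *\<^sub>R mat 1) \<in> C" if "\<And>z. z \<bullet> (N *v z) \<le> 0" "\<delta> > 0" "t > 0" for N \<delta> t
  proof -
    have "z \<bullet> ((t *\<^sub>R (N - \<delta> *\<^sub>R mat 1)) *v z) < 0" if "z \<noteq> 0" for z
    proof -
      have "z \<bullet> ((t *\<^sub>R (N - \<delta> *\<^sub>R mat 1)) *v z) = t * (z \<bullet> (N *v z) - \<delta> * (z \<bullet> z))"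
        by (simp add: matrix_vector_mult_diff_rdistrib inner_simps flip: scaleR_matrix_vector_assoc)
      moreover have "z \<bullet> (N *v z) - \<delta> * (z \<bullet> z) < 0"
        using \<open>\<And>z. z \<bullet> (N *v z) \<le> 0\<close>[of z] \<open>\<delta> > 0\<close> \<open>z \<noteq> 0\<close>
        by (smt (verit) inner_gt_zero_iff mult_pos_pos)
      ultimately show ?thesis using \<open>t > 0\<close> by (simp add: mult_pos_neg)
    qed
    then show ?thesis by (simp add: C_def)
  qed
  have "1 *\<^sub>R (0 - 1 *\<^sub>R mat 1) \<in> C" by (rule shifted) auto
  then have "C \<noteq> {}" by blast
  moreover have "convex ((+) \<Theta> ` S)" using S by (simp add: convex_translation subspace_imp_convex)
  moreover have "(+) \<Theta> ` S \<noteq> {}" using subspace_0[OF S] by blast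
  moreover have "C \<inter> (+) \<Theta> ` S = {}" using infeasible by (auto simp: C_def)
  ultimately obtain W b where "W \<noteq> 0" and below: "\<And>N. N \<in> C \<Longrightarrow> W \<bullet> N \<le> b"
    and above: "\<And>N. N \<in> S \<Longrightarrow> b \<le> W \<bullet> (\<Theta> + N)"
    using separating_hyperplane_sets[OF \<open>convex C\<close>, of "(+) \<Theta> ` S"] by (metis imageI)
  have WS: "W \<bullet> N = 0" if "N \<in> S" for N
  proof (rule ccontr)
    assume c: "W \<bullet> N \<noteq> 0"
    define t where "t = (b - W \<bullet> \<Theta> - 1) / (W \<bullet> N)"
    have "t *\<^sub>R N \<in> S" using S that by (rule subspace_scale)
    then have "b \<le> W \<bullet> (\<Theta> + t *\<^sub>R N)" by (rule above)
    also have "\<dots> = b - 1" using c by (simp add: inner_simps t_def)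
    finally show False by simp
  qed
  have bound: "t * (W \<bullet> N) - t * \<delta> * (W \<bullet> mat 1) \<le> b"
    if "\<And>z. z \<bullet> (N *v z) \<le> 0" "\<delta> > 0" "t > 0" for N \<delta> t
    using below[OF shifted[OF that]] by (simp add: inner_simps algebra_simps)
  (* The cone comes arbitrarily close to 0; the shift below is small enough to contradict b < 0. *)
  have "b \<ge> 0"
  proof (rule ccontr)
    assume "\<not> b \<ge> 0"
    have "1 * (W \<bullet> 0) - 1 * (- b / (2 * (\<bar>W \<bullet> mat 1\<bar> + 1))) * (W \<bullet> mat 1) \<le> b"
      using \<open>\<not> b \<ge> 0\<close> by (intro bound) (auto simp: divide_neg_pos)
    then have "b * (W \<bullet> mat 1) / (2 * (\<bar>W \<bullet> mat 1\<bar> + 1)) \<le> b" by simp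
    then have "b * (W \<bullet> mat 1) \<le> b * (2 * (\<bar>W \<bullet> mat 1\<bar> + 1))" by (simp add: pos_divide_le_eq)
    then have "2 * (\<bar>W \<bullet> mat 1\<bar> + 1) \<le> W \<bullet> mat 1"
      using \<open>\<not> b \<ge> 0\<close> by (simp add: mult_le_cancel_left)
    then show False using abs_ge_self[of "W \<bullet> mat 1"] abs_ge_zero[of "W \<bullet> mat 1"]
      unfolding distrib_left by linarith
  qed
  (* The cone is closed under scaling, so a functional bounded above on it is nonpositive there. *)
  have Wneg: "W \<bullet> N \<le> 0" if "\<And>z. z \<bullet> (N *v z) \<le> 0" for N
  proof (rule ccontr)
    assume pos: "\<not> W \<bullet> N \<le> 0"
    define t where "t = (b + \<bar>W \<bullet> mat 1\<bar> + 1) / (W \<bullet> N)"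
    have "t > 0" using pos \<open>b \<ge> 0\<close> by (auto simp: t_def intro!: divide_pos_pos)
    then have "t * (W \<bullet> N) - t * (1 / t) * (W \<bullet> mat 1) \<le> b" by (intro bound that) auto
    moreover have "t * (W \<bullet> N) = b + \<bar>W \<bullet> mat 1\<bar> + 1" using pos by (simp add: t_def)
    moreover have "t * (1 / t) = 1" using \<open>t > 0\<close> by simp
    ultimately show False by simp
  qed
  have psd: "0 \<le> z \<bullet> (W *v z)" for z
  proof -
    (* minus the outer product of z with itself *)
    let ?N = "\<chi> i j. - (z $ i * z $ j)"
    have "x \<bullet> (?N *v x) = - ((z \<bullet> x)\<^sup>2)" for x
      by (simp add: inner_vec_def matrix_vector_mult_def power2_eq_square sum_distrib_left
          sum_distrib_right sum_negf mult_ac)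
    then have "W \<bullet> ?N \<le> 0" by (intro Wneg) simp
    also have "W \<bullet> ?N = - (z \<bullet> (W *v z))"
      by (simp add: inner_vec_def matrix_vector_mult_def sum_distrib_left sum_negf mult_ac)
    finally show ?thesis by simp
  qed
  have sym: "transpose W = W"
  proof -
    let ?K = "W - transpose W"
    have "W \<bullet> ?K = 0" by (rule WS[OF skew])
    moreover have "transpose W \<bullet> ?K = - (W \<bullet> ?K)"
      using inner_transpose[of W W] inner_transpose[of W "transpose W"]
      by (simp add: inner_simps inner_commute)
    ultimately have "?K \<bullet> ?K = 0" by (simp add: inner_diff_left)
    then show ?thesis by simp
  qed
  have "0 \<le> W \<bullet> \<Theta>" using above[OF subspace_0[OF S]] \<open>b \<ge> 0\<close> by simp
  from that[OF \<open>W \<noteq> 0\<close> sym psd WS this] show ?thesis .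
qed

section \<open>Complexification of real matrices\<close>

lemma cmatrix_mult: "cmatrix (M ** N) = cmatrix M ** cmatrix N"
  by (simp add: cmatrix_def matrix_matrix_mult_def vec_eq_iff)

lemma cmatrix_add: "cmatrix (M + N) = cmatrix M + cmatrix N"
  by (simp add: cmatrix_def vec_eq_iff)

lemma cmatrix_diff: "cmatrix (M - N) = cmatrix M - cmatrix N"
  by (simp add: cmatrix_def vec_eq_iff)

lemma cmatrix_mat: "cmatrix (mat a) = mat (of_real a)"
  by (simp add: cmatrix_def mat_def vec_eq_iff)

lemma cmatrix_0: "cmatrix 0 = 0"
  by (simp add: cmatrix_def vec_eq_iff)

lemma adjoint_cmatrix: "adjoint_matrix (cmatrix M) = cmatrix (transpose M)"
  by (simp add: cmatrix_def adjoint_matrix_def transpose_def vec_eq_iff)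

lemma inner_cmatrix: "cmatrix M \<bullet> cmatrix N = M \<bullet> N"
  by (simp add: cmatrix_def inner_vec_def inner_complex_def)

definition re_vec :: "complex^'n \<Rightarrow> real^'n" where "re_vec z = (\<chi> i. Re (z $ i))"
definition im_vec :: "complex^'n \<Rightarrow> real^'n" where "im_vec z = (\<chi> i. Im (z $ i))"

lemma re_im_vec_simps:
  "re_vec (x + y) = re_vec x + re_vec y" "im_vec (x + y) = im_vec x + im_vec y"
  "re_vec (x - y) = re_vec x - re_vec y" "im_vec (x - y) = im_vec x - im_vec y"
  "re_vec (a *s x) = Re a *\<^sub>R re_vec x - Im a *\<^sub>R im_vec x"
  "im_vec (a *s x) = Im a *\<^sub>R re_vec x + Re a *\<^sub>R im_vec x"
  "re_vec 0 = 0" "im_vec 0 = 0"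
  by (simp_all add: re_vec_def im_vec_def vec_eq_iff)

lemma re_im_cmatrix:
  "re_vec (cmatrix M *v z) = M *v re_vec z" "im_vec (cmatrix M *v z) = M *v im_vec z"
  by (simp_all add: re_vec_def im_vec_def cmatrix_def matrix_vector_mult_def vec_eq_iff)

lemma inner_re_im: "x \<bullet> y = re_vec x \<bullet> re_vec y + im_vec x \<bullet> im_vec y"
  by (simp add: inner_vec_def inner_complex_def re_vec_def im_vec_def sum.distrib)

lemma re_im_eq_0: "z = 0 \<longleftrightarrow> re_vec z = 0 \<and> im_vec z = 0"
  by (auto simp: re_vec_def im_vec_def vec_eq_iff complex_eq_iff)

section \<open>The Kalman-Yakubovich-Popov lemma\<close>

text \<open>
The strict version without controllability: a quadratic form that is negative on all complex vectors
with \<open>M\<^sub>1 z = 0\<close> or \<open>M\<^sub>2 z = i\<omega> M\<^sub>1 z\<close> becomes negative on all real vectors after adding the derivative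
of a quadratic storage function \<open>P\<close>. A dual certificate \<open>W\<close> against the existence of \<open>P\<close> is balanced between
\<open>M\<^sub>1\<close> and \<open>M\<^sub>2\<close>, as one sees by testing it with the direction \<open>Z = M\<^sub>2 W M\<^sub>1\<^sup>T + M\<^sub>1 W M\<^sub>2\<^sup>T\<close> itself.
\<close>

lemma kalman_yakubovich_popov:
  fixes M1 M2 :: "real^'k^'n" and \<Theta> :: "real^'k^'k"
  assumes freq: "\<And>z. z \<noteq> 0 \<Longrightarrow> cmatrix M1 *v z = 0 \<or>
      (\<exists>\<omega>::real. cmatrix M2 *v z = (\<i> * of_real \<omega>) *s (cmatrix M1 *v z)) \<Longrightarrow>
      z \<bullet> (cmatrix \<Theta> *v z) < 0"
  obtains P where "transpose P = P"
    and "\<And>z. z \<noteq> 0 \<Longrightarrow> 2 * ((P *v (M1 *v z)) \<bullet> (M2 *v z)) + z \<bullet> (\<Theta> *v z) < 0"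
proof -
  (* Only the form of N is prescribed, so that S contains all skew-symmetric matrices. *)
  define S where "S = {N :: real^'k^'k. \<exists>Q. transpose Q = Q \<and>
    (\<forall>z. z \<bullet> (N *v z) = 2 * ((Q *v (M1 *v z)) \<bullet> (M2 *v z)))}"
  have "\<exists>N\<in>S. \<forall>z. z \<noteq> 0 \<longrightarrow> z \<bullet> ((\<Theta> + N) *v z) < 0"
  proof (rule ccontr)
    assume infeasible: "\<not> ?thesis"
    have "subspace S"
    proof (rule subspaceI)
      show "0 \<in> S" unfolding S_def
        by (intro CollectI exI[of _ 0]) (simp add: transpose_def vec_eq_iff)
    next
      fix M N assume "M \<in> S" "N \<in> S"
      then obtain Q R where "transpose Q = Q" "transpose R = R"
        "\<And>z. z \<bullet> (M *v z) = 2 * ((Q *v (M1 *v z)) \<bullet> (M2 *v z))"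
        "\<And>z. z \<bullet> (N *v z) = 2 * ((R *v (M1 *v z)) \<bullet> (M2 *v z))"
        by (auto simp: S_def)
      then show "M + N \<in> S" unfolding S_def
        by (intro CollectI exI[of _ "Q + R"])
          (simp add: transpose_add matrix_vector_mult_add_rdistrib inner_simps)
    next
      fix M and a :: real assume "M \<in> S"
      then obtain Q where "transpose Q = Q"
        "\<And>z. z \<bullet> (M *v z) = 2 * ((Q *v (M1 *v z)) \<bullet> (M2 *v z))"
        by (auto simp: S_def)
      then show "a *\<^sub>R M \<in> S" unfolding S_def
        by (intro CollectI exI[of _ "a *\<^sub>R Q"])
          (simp add: transpose_scalar flip: scaleR_matrix_vector_assoc)
    qed
    moreover have "K - transpose K \<in> S" for K
    proof -
      have "z \<bullet> ((K - transpose K) *v z) = 0" for z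
        using inner_mult_transpose[of z K z]
        by (simp add: matrix_vector_mult_diff_rdistrib inner_simps inner_commute)
      then show ?thesis unfolding S_def
        by (intro CollectI exI[of _ 0]) (simp add: transpose_def vec_eq_iff)
    qed
    ultimately obtain W where W: "W \<noteq> 0" "transpose W = W" "\<And>z. 0 \<le> z \<bullet> (W *v z)"
      and WS: "\<And>N. N \<in> S \<Longrightarrow> W \<bullet> N = 0" and W\<Theta>: "0 \<le> W \<bullet> \<Theta>"
      using lmi_alternative infeasible by blast
    define Z where "Z = M2 ** W ** transpose M1 + M1 ** W ** transpose M2"
    have Zsym: "transpose Z = Z"
      by (simp add: Z_def transpose_add matrix_transpose_mul W matrix_mul_assoc add.commute)
    let ?L = "transpose M1 ** (Z ** M2) + transpose M2 ** (Z ** M1)"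
    have "z \<bullet> (?L *v z) = 2 * ((Z *v (M1 *v z)) \<bullet> (M2 *v z))" for z
    proof -
      have "z \<bullet> (?L *v z) = (M1 *v z) \<bullet> (Z *v (M2 *v z)) + (M2 *v z) \<bullet> (Z *v (M1 *v z))"
        by (simp add: matrix_vector_mult_add_rdistrib inner_simps inner_mult_transpose
            del: transpose_matrix_vector flip: matrix_vector_mul_assoc)
      also have "(M1 *v z) \<bullet> (Z *v (M2 *v z)) = (Z *v (M1 *v z)) \<bullet> (M2 *v z)"
        using inner_mult_transpose[of "M1 *v z" Z] Zsym by simp
      finally show ?thesis by (simp add: inner_commute)
    qed
    then have "?L \<in> S" unfolding S_def using Zsym by blast
    then have "W \<bullet> ?L = 0" by (rule WS)
    moreover have "W \<bullet> ?L = Z \<bullet> Z"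
    proof -
      have "W \<bullet> (transpose M1 ** (Z ** M2)) = (M1 ** W ** transpose M2) \<bullet> Z"
        by (simp add: inner_matrix_mult(1)[of W] inner_matrix_mult(2)[of _ Z M2])
      moreover have "W \<bullet> (transpose M2 ** (Z ** M1)) = (M2 ** W ** transpose M1) \<bullet> Z"
        by (simp add: inner_matrix_mult(1)[of W] inner_matrix_mult(2)[of _ Z M1])
      ultimately show ?thesis by (simp add: Z_def inner_add_left inner_add_right)
    qed
    ultimately have "Z = 0" by simp
    have "cmatrix \<Theta> \<bullet> cmatrix W < 0"
    proof (rule balanced_psd_inner_neg[OF freq])
      show "adjoint_matrix (cmatrix W) = cmatrix W" by (simp add: adjoint_cmatrix W)
      show "0 \<le> x \<bullet> (cmatrix W *v x)" for x
        by (simp add: inner_re_im re_im_cmatrix W)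
      show "cmatrix W \<noteq> 0" using W(1) by (auto simp: cmatrix_def vec_eq_iff)
      have "cmatrix Z = 0" using \<open>Z = 0\<close> by (simp add: cmatrix_0)
      then show "cmatrix M2 ** cmatrix W ** adjoint_matrix (cmatrix M1)
          + cmatrix M1 ** cmatrix W ** adjoint_matrix (cmatrix M2) = 0"
        by (simp add: Z_def adjoint_cmatrix cmatrix_add cmatrix_mult)
    qed
    then show False using W\<Theta> by (simp add: inner_cmatrix inner_commute)
  qed
  then obtain N Q where "transpose Q = Q" and neg: "\<And>z. z \<noteq> 0 \<Longrightarrow> z \<bullet> ((\<Theta> + N) *v z) < 0"
    and N: "\<And>z. z \<bullet> (N *v z) = 2 * ((Q *v (M1 *v z)) \<bullet> (M2 *v z))"
    by (auto simp: S_def)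
  moreover have "2 * ((Q *v (M1 *v z)) \<bullet> (M2 *v z)) + z \<bullet> (\<Theta> *v z) < 0" if "z \<noteq> 0" for z
    using neg[OF that] by (simp add: matrix_vector_mult_add_rdistrib inner_simps N)
  ultimately show ?thesis using that by blast
qed

section \<open>Lyapunov's theorem\<close>

text \<open>
A vector field that strictly decreases two quadratic forms, one of which is positive definite, cannot
separate their signs. If \<open>P\<close> is not positive definite, some \<open>P + \<mu> Q\<close> with \<open>\<mu> \<ge> 0\<close> is positive semidefinite
and singular; at a kernel vector \<open>v\<close> its derivative along \<open>f\<close> is zero, although both summands decrease.
\<close>

lemma lyapunov_form_positive:
  fixes f P Q :: "'a::euclidean_space \<Rightarrow> 'a"
  assumes P: "linear P" and Q: "linear Q"
    and Ps: "\<And>x y. x \<bullet> P y = P x \<bullet> y" and Qs: "\<And>x y. x \<bullet> Q y = Q x \<bullet> y"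
    and Qpos: "\<And>x. x \<noteq> 0 \<Longrightarrow> 0 < x \<bullet> Q x"
    and Plyap: "\<And>x. x \<noteq> 0 \<Longrightarrow> P x \<bullet> f x < 0" and Qlyap: "\<And>x. x \<noteq> 0 \<Longrightarrow> Q x \<bullet> f x < 0"
    and "x \<noteq> 0"
  shows "0 < x \<bullet> P x"
proof (rule ccontr)
  assume neg: "\<not> 0 < x \<bullet> P x"
  have Q0: "Q y = 0 \<longleftrightarrow> y = 0" for y using Qpos[of y] linear_0[OF Q] by fastforce
  have "Q x \<noteq> 0" using Q0 \<open>x \<noteq> 0\<close> by simp
  obtain v \<mu> where v: "Q v \<noteq> 0" "- P v = \<mu> *\<^sub>R Q v" and max: "\<And>y. y \<bullet> - P y \<le> \<mu> * (y \<bullet> Q y)"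
  proof (rule rayleigh_maximizer[of "\<lambda>y. - P y" Q])
    show "linear (\<lambda>y. - P y)" using P by (rule linear_compose_neg)
    show "0 \<le> y \<bullet> Q y" for y using Qpos[of y] by (cases "y = 0") auto
    show "- P y = 0" if "Q y = 0" for y using that Q0 linear_0[OF P] by auto
    show "Q x \<noteq> 0" by fact
  qed (use Q Ps Qs in \<open>auto\<close>)
  have "0 \<le> \<mu> * (x \<bullet> Q x)" using max[of x] neg by simp
  then have "\<mu> \<ge> 0" using Qpos[OF \<open>x \<noteq> 0\<close>] by (simp add: zero_le_mult_iff)
  have "v \<noteq> 0" using v Q0 by auto
  have "P v = - (\<mu> *\<^sub>R Q v)" using v(2) by (metis minus_minus)
  then have "P v \<bullet> f v = - (\<mu> * (Q v \<bullet> f v))" by simp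
  then show False using Plyap[OF \<open>v \<noteq> 0\<close>] Qlyap[OF \<open>v \<noteq> 0\<close>] \<open>\<mu> \<ge> 0\<close>
    by (smt (verit) mult_nonneg_nonneg mult_minus_right)
qed

lemma transpose_self_inner: "transpose P = P \<Longrightarrow> x \<bullet> (P *v y) = (P *v x) \<bullet> y" for P :: "real^'n^'n"
  using inner_mult_transpose[of x P y] by simp

lemma mat_mult_vec: "mat a *v x = a *s x" for x :: "'a::semiring_1^'n"
  by (simp add: vec_eq_iff matrix_vector_mult_def mat_def if_distrib[of "\<lambda>c. c * _"] cong: if_cong)

lemma lyapunov_solution_pos_definite:
  fixes A P Q :: "real^'n^'n"
  assumes "transpose P = P" and "pos_definite Q"
    and "\<And>x. x \<noteq> 0 \<Longrightarrow> (P *v x) \<bullet> (A *v x) < 0" and "\<And>x. x \<noteq> 0 \<Longrightarrow> (Q *v x) \<bullet> (A *v x) < 0"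
  shows "pos_definite P"
  unfolding pos_definite_def
proof (intro conjI allI impI)
  fix x :: "real^'n" assume "x \<noteq> 0"
  show "0 < x \<bullet> (P *v x)"
  proof (rule lyapunov_form_positive[of "(*v) P" "(*v) Q" "(*v) A"])
    show "x \<bullet> (P *v y) = (P *v x) \<bullet> y" for x y using assms(1) by (rule transpose_self_inner)
    show "x \<bullet> (Q *v y) = (Q *v x) \<bullet> y" for x y
      using assms(2) by (intro transpose_self_inner) (simp add: pos_definite_def)
    show "0 < x \<bullet> (Q *v x)" if "x \<noteq> 0" for x using assms(2) that by (simp add: pos_definite_def)
  qed (use assms \<open>x \<noteq> 0\<close> in auto)
qed (fact assms(1))

lemma lyapunov_symmetric_solution:
  fixes A :: "real^'n^'n"
  assumes no_imag: "\<And>\<omega>::real. \<not> is_eigenvalue (cmatrix A) (\<i> * of_real \<omega>)"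
  obtains P where "transpose P = P" and "\<And>z. z \<noteq> 0 \<Longrightarrow> (P *v z) \<bullet> (A *v z) < 0"
proof -
  have "z \<bullet> (cmatrix 0 *v z) < 0"
    if "z \<noteq> 0" "cmatrix (mat 1 :: real^'n^'n) *v z = 0 \<or>
      (\<exists>\<omega>::real. cmatrix A *v z = (\<i> * of_real \<omega>) *s (cmatrix (mat 1 :: real^'n^'n) *v z))"
    for z :: "complex^'n"
    using that no_imag by (auto simp: cmatrix_mat is_eigenvalue_def)
  then obtain P where "transpose P = P" "\<And>z. z \<noteq> 0 \<Longrightarrow>
      2 * ((P *v ((mat 1 :: real^'n^'n) *v z)) \<bullet> (A *v z)) + z \<bullet> (0 *v z) < 0"
    using kalman_yakubovich_popov[of "mat 1 :: real^'n^'n" A 0] by blast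
  with that show ?thesis by simp
qed

text \<open>
Homotopy along \<open>A - t I\<close>, \<open>t \<ge> 0\<close>. None of these matrices has an imaginary eigenvalue, so each has a
symmetric Lyapunov solution, which still works for nearby \<open>t\<close>. As all symmetric solutions for the same \<open>t\<close>
are positive definite or none is, positive definiteness is a locally constant property of \<open>t\<close>; it holds
for large \<open>t\<close>, where the identity matrix is a solution.
\<close>

lemma hurwitz_imp_lyapunov:
  fixes A :: "real^'n^'n"
  assumes "hurwitz A"
  obtains P where "pos_definite P" and "\<And>z. z \<noteq> 0 \<Longrightarrow> (P *v z) \<bullet> (A *v z) < 0"
proof -
  define lyap where "lyap t P \<longleftrightarrow> (\<forall>z. z \<noteq> 0 \<longrightarrow> (P *v z) \<bullet> ((A - mat t) *v z) < 0)"
    for t :: real and P :: "real^'n^'n"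
  define \<Phi> where "\<Phi> t \<longleftrightarrow> (\<exists>P. pos_definite P \<and> lyap t P)" for t
  have \<Phi>_iff: "\<Phi> t \<longleftrightarrow> pos_definite P" if "transpose P = P" "lyap t P" for t P
    using lyapunov_solution_pos_definite[of P _ "A - mat t"] that by (auto simp: \<Phi>_def lyap_def)
  have shift: "(P *v z) \<bullet> ((A - mat s) *v z) = z \<bullet> ((transpose P ** (A - mat t)) *v z) + (t - s) * (z \<bullet> (P *v z))"
    for P z s t
    by (simp add: inner_mult_transpose mat_mult_vec matrix_vector_mult_diff_rdistrib inner_simps
        scalar_mult_eq_scaleR inner_commute algebra_simps
        del: transpose_matrix_vector flip: matrix_vector_mul_assoc)
  have form_bound: "\<bar>z \<bullet> (M *v z)\<bar> \<le> onorm ((*v) M) * (z \<bullet> z)" for z and M :: "real^'n^'n"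
  proof -
    have "\<bar>z \<bullet> (M *v z)\<bar> \<le> norm z * norm (M *v z)" by (rule Cauchy_Schwarz_ineq2)
    also have "\<dots> \<le> norm z * (onorm ((*v) M) * norm z)"
      by (intro mult_left_mono onorm) (auto simp: matrix_vector_mul_bounded_linear)
    finally show ?thesis by (simp add: power2_norm_eq_inner[symmetric] power2_eq_square mult_ac)
  qed
  have local_const: "\<forall>\<^sub>F s in at t within {0..}. \<Phi> t = \<Phi> s" if "t \<in> {0..}" for t
  proof -
    have "\<not> is_eigenvalue (cmatrix (A - mat t)) (\<i> * of_real \<omega>)" for \<omega>
    proof
      assume "is_eigenvalue (cmatrix (A - mat t)) (\<i> * of_real \<omega>)"
      then obtain v where "v \<noteq> 0" "cmatrix (A - mat t) *v v = (\<i> * of_real \<omega>) *s v"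
        by (auto simp: is_eigenvalue_def)
      then have "cmatrix A *v v = (of_real t + \<i> * of_real \<omega>) *s v"
        by (simp add: cmatrix_diff cmatrix_mat matrix_vector_mult_diff_rdistrib mat_mult_vec
            vector_sadd_rdistrib algebra_simps)
      then have "is_eigenvalue (cmatrix A) (of_real t + \<i> * of_real \<omega>)"
        using \<open>v \<noteq> 0\<close> by (auto simp: is_eigenvalue_def)
      then have "Re (of_real t + \<i> * of_real \<omega>) < 0" using assms unfolding hurwitz_def by blast
      with that show False by simp
    qed
    then obtain P where P: "transpose P = P" "\<And>z. z \<noteq> 0 \<Longrightarrow> (P *v z) \<bullet> ((A - mat t) *v z) < 0"
      by (rule lyapunov_symmetric_solution) blast
    let ?h = "\<lambda>z. (transpose P ** (A - mat t)) *v z"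
    have h: "z \<bullet> ?h z = (P *v z) \<bullet> ((A - mat t) *v z)" for z using shift[of P z t t] by simp
    obtain \<epsilon> where "\<epsilon> > 0" and \<epsilon>: "\<And>z. z \<bullet> ?h z \<le> - \<epsilon> * (z \<bullet> z)"
      by (rule compact_form_bound[of ?h]) (use P(2) h in auto)
    define M where "M = onorm ((*v) P)"
    have "M \<ge> 0" unfolding M_def by (rule onorm_pos_le) (simp add: matrix_vector_mul_bounded_linear)
    have "lyap s P" if "dist s t < \<epsilon> / (M + 1)" for s
      unfolding lyap_def
    proof (intro allI impI)
      fix z :: "real^'n" assume "z \<noteq> 0"
      then have zz: "z \<bullet> z > 0" by simp
      have "\<bar>t - s\<bar> * (M + 1) < \<epsilon>"
        using that \<open>M \<ge> 0\<close> by (simp add: pos_less_divide_eq dist_real_def abs_minus_commute)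
      then have small: "\<bar>t - s\<bar> * M < \<epsilon>" by (simp add: distrib_left)
      have "(t - s) * (z \<bullet> (P *v z)) \<le> \<bar>t - s\<bar> * \<bar>z \<bullet> (P *v z)\<bar>"
        by (metis abs_ge_self abs_mult)
      also have "\<dots> \<le> \<bar>t - s\<bar> * (M * (z \<bullet> z))"
        unfolding M_def by (intro mult_left_mono form_bound) auto
      also have "\<dots> < \<epsilon> * (z \<bullet> z)"
        using mult_strict_right_mono[OF small zz] by (simp add: mult_ac)
      finally show "(P *v z) \<bullet> ((A - mat s) *v z) < 0"
        using shift[of P z s t] \<epsilon>[of z] by linarith
    qed
    moreover have "\<epsilon> / (M + 1) > 0" using \<open>\<epsilon> > 0\<close> \<open>M \<ge> 0\<close> by simp
    ultimately have "\<forall>\<^sub>F s in at t within {0..}. lyap s P"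
      unfolding eventually_at by blast
    moreover have "lyap t P" using P by (simp add: lyap_def)
    ultimately show ?thesis using \<Phi>_iff[OF P(1)] by (auto elim!: eventually_mono)
  qed
  define T where "T = onorm ((*v) A) + 1"
  have "T \<ge> 0" unfolding T_def
    using onorm_pos_le[of "(*v) A"] by (simp add: matrix_vector_mul_bounded_linear)
  have "pos_definite (mat 1 :: real^'n^'n)" by (simp add: pos_definite_def)
  moreover have "lyap T (mat 1)"
    unfolding lyap_def
  proof (intro allI impI)
    fix z :: "real^'n" assume "z \<noteq> 0"
    then have "z \<bullet> z > 0" by simp
    moreover have "(mat 1 *v z) \<bullet> ((A - mat T) *v z) = z \<bullet> (A *v z) - T * (z \<bullet> z)"
      by (simp add: mat_mult_vec matrix_vector_mult_diff_rdistrib inner_simps scalar_mult_eq_scaleR)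
    ultimately show "(mat 1 *v z) \<bullet> ((A - mat T) *v z) < 0"
      using form_bound[of z A] unfolding T_def distrib_right by linarith
  qed
  ultimately have "\<Phi> T" unfolding \<Phi>_def by blast
  moreover have "\<Phi> 0 = \<Phi> T"
    by (rule connected_local_const[of "{0..}"]) (use \<open>T \<ge> 0\<close> local_const in \<open>auto simp: convex_connected\<close>)
  ultimately have "\<Phi> 0" by simp
  moreover have "A - mat 0 = A" by (simp add: mat_def vec_eq_iff)
  ultimately show ?thesis using that by (auto simp: \<Phi>_def lyap_def)
qed

text \<open>
For a complex eigenvector \<open>a + i b\<close> with eigenvalue \<open>s\<close>, the derivative of the form of \<open>P\<close>, summed over
\<open>a\<close> and \<open>b\<close>, is \<open>Re s\<close> times a positive number: the terms with \<open>Im s\<close> cancel by symmetry of \<open>P\<close>.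
\<close>

lemma lyapunov_imp_hurwitz:
  fixes A P :: "real^'n^'n"
  assumes P: "pos_definite P" and lyap: "\<And>z. z \<noteq> 0 \<Longrightarrow> (P *v z) \<bullet> (A *v z) < 0"
  shows "hurwitz A"
  unfolding hurwitz_def
proof (intro allI impI)
  fix s assume "is_eigenvalue (cmatrix A) s"
  then obtain v where "v \<noteq> 0" and v: "cmatrix A *v v = s *s v" by (auto simp: is_eigenvalue_def)
  define a b where "a = re_vec v" and "b = im_vec v"
  have Aa: "A *v a = Re s *\<^sub>R a - Im s *\<^sub>R b" and Ab: "A *v b = Im s *\<^sub>R a + Re s *\<^sub>R b"
    using arg_cong[OF v, of re_vec] arg_cong[OF v, of im_vec]
    by (simp_all add: re_im_cmatrix re_im_vec_simps a_def b_def)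
  have sym: "(P *v a) \<bullet> b = (P *v b) \<bullet> a"
    using transpose_self_inner[of P a b] P by (simp add: pos_definite_def inner_commute)
  have "a \<noteq> 0 \<or> b \<noteq> 0" using \<open>v \<noteq> 0\<close> re_im_eq_0[of v] by (auto simp: a_def b_def)
  moreover have "(P *v a) \<bullet> (A *v a) \<le> 0" "(P *v b) \<bullet> (A *v b) \<le> 0"
    using lyap[of a] lyap[of b] by (cases "a = 0"; cases "b = 0"; simp)+
  ultimately have "(P *v a) \<bullet> (A *v a) + (P *v b) \<bullet> (A *v b) < 0"
    using lyap[of a] lyap[of b] by linarith
  also have "(P *v a) \<bullet> (A *v a) + (P *v b) \<bullet> (A *v b)
      = Re s * ((P *v a) \<bullet> a + (P *v b) \<bullet> b)"
    by (simp add: Aa Ab inner_simps sym algebra_simps)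
  finally have "Re s * ((P *v a) \<bullet> a + (P *v b) \<bullet> b) < 0" .
  moreover have "(P *v a) \<bullet> a \<ge> 0" "(P *v b) \<bullet> b \<ge> 0"
    using P unfolding pos_definite_def
    by (metis inner_commute inner_zero_left less_eq_real_def)+
  ultimately show "Re s < 0" by (smt (verit) mult_nonneg_nonneg)
qed

section \<open>Singular values\<close>

text \<open>
Eigenvectors for distinct real eigenvalues are orthogonal, hence independent. Finiteness is what makes the
maximum over the set of singular values meaningful.
\<close>

lemma finite_hermitian_real_spectrum:
  fixes H :: "complex^'n^'n"
  assumes "adjoint_matrix H = H"
  shows "finite {r::real. is_eigenvalue H (of_real r)}" (is "finite ?R")
proof -
  have "\<forall>r\<in>?R. \<exists>v. v \<noteq> 0 \<and> H *v v = r *\<^sub>R v"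
    by (auto simp: is_eigenvalue_def scaleR_eq_smult)
  then obtain v where v: "\<And>r. r \<in> ?R \<Longrightarrow> v r \<noteq> 0 \<and> H *v v r = r *\<^sub>R v r" by metis
  have orth: "v r \<bullet> v s = 0" if "r \<in> ?R" "s \<in> ?R" "r \<noteq> s" for r s
  proof -
    have "s * (v r \<bullet> v s) = v r \<bullet> (H *v v s)" using v[OF that(2)] by simp
    also have "\<dots> = r * (v r \<bullet> v s)" using v[OF that(1)] inner_adjoint[of "v r" H] assms by simp
    finally show ?thesis using that(3) by simp
  qed
  have "inj_on v ?R"
  proof (rule inj_onI, rule ccontr)
    fix r s assume rs: "r \<in> ?R" "s \<in> ?R" "v r = v s" "r \<noteq> s"
    then have "v r \<bullet> v r = 0" using orth[OF rs(1,2,4)] by simp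
    with v[OF rs(1)] show False by simp
  qed
  moreover have "independent (v ` ?R)"
  proof (rule pairwise_orthogonal_independent)
    show "pairwise orthogonal (v ` ?R)"
      using orth by (auto simp: pairwise_def orthogonal_def)
    show "0 \<notin> v ` ?R" using v by auto
  qed
  ultimately show ?thesis using finite_imageD independent_imp_finite by blast
qed

lemma singular_valueE:
  assumes "s \<in> singular_values M"
  obtains v where "v \<noteq> 0" and "norm (M *v v) = s * norm v"
proof -
  obtain v where "v \<noteq> 0" and s: "s \<ge> 0" and v: "(adjoint_matrix M ** M) *v v = of_real (s\<^sup>2) *s v"
    using assms by (auto simp: singular_values_def is_eigenvalue_def)
  have "(M *v v) \<bullet> (M *v v) = (s\<^sup>2 *\<^sub>R v) \<bullet> v"
    using inner_adjoint[of "M *v v" M v] v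
    by (simp add: matrix_vector_mul_assoc scaleR_eq_smult)
  then have "(norm (M *v v))\<^sup>2 = (s * norm v)\<^sup>2"
    by (simp add: power2_norm_eq_inner power_mult_distrib)
  then have "norm (M *v v) = s * norm v" using s by (simp add: power2_eq_iff_nonneg)
  with \<open>v \<noteq> 0\<close> that show ?thesis by blast
qed

text \<open>
The maximum singular value is the operator norm: the Rayleigh quotient of \<open>M\<^sup>* M\<close> attains its maximum
at an eigenvector, whose eigenvalue is the square of a singular value.
\<close>

lemma
  fixes M :: "complex^'n^'m"
  shows max_singular_value_mem: "max_singular_value M \<in> singular_values M"
    and norm_le_max_singular_value: "norm (M *v v) \<le> max_singular_value M * norm v"
proof -
  let ?H = "adjoint_matrix M ** M"
  have herm: "adjoint_matrix ?H = ?H" by (simp add: adjoint_mult)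
  have form: "x \<bullet> (?H *v x) = (norm (M *v x))\<^sup>2" for x
    using inner_adjoint[of x "adjoint_matrix M" "M *v x"]
    by (simp add: power2_norm_eq_inner matrix_vector_mul_assoc)
  have "finite ((\<lambda>s. s\<^sup>2) ` singular_values M)"
    by (rule finite_subset[OF _ finite_hermitian_real_spectrum[OF herm]])
      (auto simp: singular_values_def)
  moreover have "inj_on (\<lambda>s. s\<^sup>2) (singular_values M)"
    by (auto simp: inj_on_def singular_values_def power2_eq_iff_nonneg)
  ultimately have fin: "finite (singular_values M)" by (rule finite_imageD)
  obtain x \<mu> where x: "x \<noteq> 0" "?H *v x = \<mu> *\<^sub>R x" and max: "\<And>v. v \<bullet> (?H *v v) \<le> \<mu> * (v \<bullet> v)"
  proof (rule rayleigh_maximizer[of "\<lambda>x. ?H *v x" id "axis undefined 1"])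
    show "x \<bullet> (?H *v y) = (?H *v x) \<bullet> y" for x y
      using inner_adjoint[of x ?H y] herm by simp
  qed (auto simp: linear_id axis_eq_0_iff)
  have "\<mu> * (x \<bullet> x) = (norm (M *v x))\<^sup>2" using form[of x] x(2) by simp
  then have "\<mu> * (x \<bullet> x) \<ge> 0" by simp
  moreover have "x \<bullet> x > 0" using \<open>x \<noteq> 0\<close> by simp
  ultimately have "\<mu> \<ge> 0" by (simp add: zero_le_mult_iff del: inner_gt_zero_iff)
  then have mem: "sqrt \<mu> \<in> singular_values M"
    using x \<open>\<mu> \<ge> 0\<close>
    by (auto simp: singular_values_def is_eigenvalue_def scaleR_eq_smult simp flip: of_real_power)
  have le: "norm (M *v v) \<le> sqrt \<mu> * norm v" for v
  proof (rule power2_le_imp_le)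
    show "(norm (M *v v))\<^sup>2 \<le> (sqrt \<mu> * norm v)\<^sup>2"
      using max[of v] form[of v] \<open>\<mu> \<ge> 0\<close> by (simp add: power_mult_distrib power2_norm_eq_inner)
  qed (use \<open>\<mu> \<ge> 0\<close> in simp)
  have "s \<le> sqrt \<mu>" if s: "s \<in> singular_values M" for s
  proof -
    obtain w where "w \<noteq> 0" "norm (M *v w) = s * norm w" using singular_valueE[OF s] .
    with le[of w] show ?thesis by simp
  qed
  then have "max_singular_value M = sqrt \<mu>"
    unfolding max_singular_value_def using fin mem by (intro Max_eqI) auto
  with mem le show "max_singular_value M \<in> singular_values M"
    and "norm (M *v v) \<le> max_singular_value M * norm v" by auto
qed

section \<open>Block vectors and the sensitivity inequality\<close>

definition vjoin :: "'a^'n \<Rightarrow> 'a^'m \<Rightarrow> 'a^('n + 'm)" where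
  "vjoin x y = (\<chi> i. case i of Inl a \<Rightarrow> x $ a | Inr b \<Rightarrow> y $ b)"

lemma sum_UNIV_sum:
  "(\<Sum>i\<in>(UNIV :: ('a::finite + 'b::finite) set). f i) = (\<Sum>a\<in>UNIV. f (Inl a)) + (\<Sum>b\<in>UNIV. f (Inr b))"
  by (simp add: sum.Plus flip: UNIV_Plus_UNIV)

lemma vjoin_exhaust: obtains x y where "z = vjoin x y"
proof
  show "z = vjoin (\<chi> a. z $ Inl a) (\<chi> b. z $ Inr b)"
    by (simp add: vjoin_def vec_eq_iff split: sum.split)
qed

lemma vjoin_eq_0_iff: "vjoin x y = 0 \<longleftrightarrow> x = 0 \<and> y = 0"
  by (auto simp: vjoin_def vec_eq_iff split: sum.splits)

lemma hcat_mult_vjoin: "(M \<parallel> N) *v vjoin x y = M *v x + N *v y"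
  by (simp add: hcat_def vjoin_def matrix_vector_mult_def vec_eq_iff sum_UNIV_sum)

lemma vcat_mult: "(M \<sslash> N) *v z = vjoin (M *v z) (N *v z)"
  by (auto simp: vcat_def vjoin_def matrix_vector_mult_def vec_eq_iff split: sum.split)

lemma inner_vjoin: "vjoin x y \<bullet> vjoin x' y' = x \<bullet> x' + y \<bullet> y'"
  by (simp add: vjoin_def inner_vec_def sum_UNIV_sum)

lemma cmatrix_hcat: "cmatrix (M \<parallel> N) = cmatrix M \<parallel> cmatrix N"
  by (simp add: cmatrix_def hcat_def vec_eq_iff split: sum.split)

lemma cmatrix_neg: "cmatrix (- M) = - cmatrix M"
  by (simp add: cmatrix_def vec_eq_iff)

lemma sensitivity_lmi_mult:
  "sensitivity_lmi A B \<gamma> X Y *v vjoin x (vjoin u y) =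
    vjoin ((A ** X + X ** transpose A - B ** Y - transpose Y ** transpose B) *v x + B *v u - transpose Y *v y)
      (vjoin (transpose B *v x - \<gamma> *\<^sub>R u + y) (- (Y *v x) + u - \<gamma> *\<^sub>R y))"
  unfolding sensitivity_lmi_def vcat_mult hcat_mult_vjoin
  by (simp add: mat_mult_vec scalar_mult_eq_scaleR neg_mult_vec algebra_simps
      del: transpose_matrix_vector)

lemma sensitivity_lmi_form:
  assumes "transpose X = X"
  shows "vjoin x (vjoin u y) \<bullet> (sensitivity_lmi A B \<gamma> X Y *v vjoin x (vjoin u y)) =
    2 * (x \<bullet> ((A ** X - B ** Y) *v x + B *v u)) + 2 * (y \<bullet> (u - Y *v x)) - \<gamma> * (u \<bullet> u) - \<gamma> * (y \<bullet> y)"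
proof -
  have X: "x \<bullet> (X *v v) = (X *v x) \<bullet> v" for v using assms by (rule transpose_self_inner)
  show ?thesis
    by (simp add: sensitivity_lmi_mult inner_vjoin inner_simps inner_mult_transpose X
        matrix_vector_mult_add_rdistrib matrix_vector_mult_diff_rdistrib inner_commute algebra_simps
        del: transpose_matrix_vector flip: matrix_vector_mul_assoc)
qed

lemma symmetric_matrixI:
  fixes M :: "real^'n^'n"
  assumes "\<And>x y. x \<bullet> (M *v y) = (M *v x) \<bullet> y"
  shows "transpose M = M"
proof -
  have "y \<bullet> (transpose M *v x) = y \<bullet> (M *v x)" for x y
    using assms[of y x] by (simp only: inner_mult_transpose)
  then have "transpose M *v x = M *v x" for x by (metis vector_eq_ldot)
  then show ?thesis unfolding matrix_eq by blast
qed

lemma sensitivity_lmi_symmetric: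
  fixes A X :: "real^'n^'n" and B :: "real^'m^'n" and Y :: "real^'n^'m"
  assumes "transpose X = X"
  shows "transpose (sensitivity_lmi A B \<gamma> X Y) = sensitivity_lmi A B \<gamma> X Y"
proof (rule symmetric_matrixI)
  fix v w :: "real^('n + 'm + 'm)"
  obtain x t x' t' where 1: "v = vjoin x t" "w = vjoin x' t'" by (metis vjoin_exhaust)
  obtain u y u' y' where 2: "t = vjoin u y" "t' = vjoin u' y'" by (metis vjoin_exhaust)
  have X: "x \<bullet> (X *v v) = (X *v x) \<bullet> v" for x v using assms by (rule transpose_self_inner)
  show "v \<bullet> (sensitivity_lmi A B \<gamma> X Y *v w) = (sensitivity_lmi A B \<gamma> X Y *v v) \<bullet> w"
    by (simp add: 1 2 sensitivity_lmi_mult inner_vjoin inner_simps inner_mult_transpose X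
        inner_mult_transpose[of _ _ x, unfolded inner_commute[of _ x]]
        inner_mult_transpose[of _ _ x', unfolded inner_commute[of _ x']]
        matrix_vector_mult_add_rdistrib matrix_vector_mult_diff_rdistrib inner_commute algebra_simps
        del: transpose_matrix_vector flip: matrix_vector_mul_assoc)
qed

section \<open>The sensitivity as a response to sinusoidal inputs\<close>

lemma resolvent_inverse:
  fixes M :: "complex^'n^'n"
  assumes "\<not> is_eigenvalue M s"
  shows "(mat s - M) ** matrix_inv (mat s - M) = mat 1" "matrix_inv (mat s - M) ** (mat s - M) = mat 1"
proof -
  have "x = 0" if "(mat s - M) *v x = 0" for x
    using that assms by (auto simp: is_eigenvalue_def matrix_vector_mult_diff_rdistrib mat_mult_vec)
  then have "invertible (mat s - M)"
    by (simp add: invertible_left_inverse matrix_left_invertible_ker)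
  then show "(mat s - M) ** matrix_inv (mat s - M) = mat 1" "matrix_inv (mat s - M) ** (mat s - M) = mat 1"
    unfolding invertible_def matrix_inv_def by (metis (mono_tags, lifting) someI_ex)+
qed

text \<open>
An input amplitude \<open>u\<close> and a state amplitude \<open>f\<close> with \<open>s f = F f + B u\<close> replace the resolvent in
everything that follows.
\<close>

lemma input_sensitivity_apply:
  assumes "\<not> is_eigenvalue (cmatrix (A - B ** K)) s"
    and f: "s *s f = cmatrix (A - B ** K) *v f + cmatrix B *v u"
  shows "input_sensitivity A B K s *v u = u - cmatrix K *v f"
proof -
  let ?R = "matrix_inv (mat s - cmatrix (A - B ** K))"
  have "(mat s - cmatrix (A - B ** K)) *v f = cmatrix B *v u"
    using f by (simp add: matrix_vector_mult_diff_rdistrib mat_mult_vec)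
  then have "?R *v (cmatrix B *v u) = f"
    using resolvent_inverse(2)[OF assms(1)] by (metis matrix_vector_mul_assoc matrix_vector_mul_lid)
  then show ?thesis
    by (simp add: input_sensitivity_def matrix_vector_mult_diff_rdistrib flip: matrix_vector_mul_assoc)
qed

lemma input_sensitivity_state:
  assumes "\<not> is_eigenvalue (cmatrix (A - B ** K)) s"
  obtains f where "s *s f = cmatrix (A - B ** K) *v f + cmatrix B *v u"
proof
  let ?f = "matrix_inv (mat s - cmatrix (A - B ** K)) *v (cmatrix B *v u)"
  have "(mat s - cmatrix (A - B ** K)) *v ?f = cmatrix B *v u"
    using resolvent_inverse(1)[OF assms] by (metis matrix_vector_mul_assoc matrix_vector_mul_lid)
  then show "s *s ?f = cmatrix (A - B ** K) *v ?f + cmatrix B *v u"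
    by (simp add: matrix_vector_mult_diff_rdistrib mat_mult_vec algebra_simps)
qed

text \<open>
The dissipation inequality is added up over the real and imaginary parts of \<open>(f, w)\<close>. The derivatives of
the storage function, \<open>- \<omega> Pa \<bullet> b\<close> and \<open>\<omega> Pb \<bullet> a\<close>, cancel.
\<close>

lemma dissipation_imp_frequency_bound:
  fixes F P :: "real^'n^'n" and B :: "real^'m^'n" and K :: "real^'n^'m"
  assumes P: "transpose P = P"
    and diss: "\<And>\<xi> u. 2 * ((P *v \<xi>) \<bullet> (F *v \<xi> + B *v u)) + (norm (u - K *v \<xi>))\<^sup>2 \<le> g * (norm u)\<^sup>2"
    and f: "(\<i> * of_real \<omega>) *s f = cmatrix F *v f + cmatrix B *v w"
  shows "(norm (w - cmatrix K *v f))\<^sup>2 \<le> g * (norm w)\<^sup>2"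
proof -
  define a b where "a = re_vec f" and "b = im_vec f"
  define u v where "u = re_vec w" and "v = im_vec w"
  have re: "F *v a + B *v u = - (\<omega> *\<^sub>R b)" and im: "F *v b + B *v v = \<omega> *\<^sub>R a"
    using arg_cong[OF f, of re_vec] arg_cong[OF f, of im_vec]
    by (simp_all add: re_im_cmatrix re_im_vec_simps a_def b_def u_def v_def)
  have norms: "(norm z)\<^sup>2 = (norm (re_vec z))\<^sup>2 + (norm (im_vec z))\<^sup>2" for z :: "complex^'m"
    by (simp add: power2_norm_eq_inner inner_re_im)
  have "(P *v a) \<bullet> b = (P *v b) \<bullet> a" using transpose_self_inner[OF P, of a b] by (simp add: inner_commute)
  then have "(P *v a) \<bullet> (F *v a + B *v u) + (P *v b) \<bullet> (F *v b + B *v v) = 0"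
    by (simp add: re im)
  then have "(norm (u - K *v a))\<^sup>2 + (norm (v - K *v b))\<^sup>2 \<le> g * (norm u)\<^sup>2 + g * (norm v)\<^sup>2"
    using diss[of a u] diss[of b v] by linarith
  then show ?thesis
    by (simp add: norms re_im_vec_simps re_im_cmatrix a_def b_def u_def v_def distrib_left)
qed

lemma hurwitz_no_imaginary: "hurwitz F \<Longrightarrow> \<not> is_eigenvalue (cmatrix F) (\<i> * of_real \<omega>)"
  unfolding hurwitz_def by fastforce

section \<open>The strict bounded real lemma\<close>

lemma matrix_inv_unique: "M ** N = mat 1 \<Longrightarrow> matrix_inv M = N" for M :: "'a::field^'n^'n"
proof -
  assume MN: "M ** N = mat 1"
  then have NM: "N ** M = mat 1" by (simp add: matrix_left_right_inverse)
  then have "invertible M" using MN unfolding invertible_def by blast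
  then have "M ** matrix_inv M = mat 1"
    unfolding invertible_def matrix_inv_def by (metis (mono_tags, lifting) someI_ex)
  then show ?thesis using NM by (metis matrix_mul_assoc matrix_mul_lid matrix_mul_rid)
qed

lemma pos_definite_inverse:
  fixes X :: "real^'n^'n"
  assumes "pos_definite X"
  shows "X ** matrix_inv X = mat 1" "matrix_inv X ** X = mat 1" "pos_definite (matrix_inv X)"
proof -
  have "x = 0" if "X *v x = 0" for x
    using assms that unfolding pos_definite_def by (metis inner_zero_right less_irrefl)
  then obtain Q where "Q ** X = mat 1" using matrix_left_invertible_ker[of X] by blast
  then have XQ: "X ** Q = mat 1" by (simp add: matrix_left_right_inverse)
  then show inv: "X ** matrix_inv X = mat 1" using matrix_inv_unique by metis
  then show inv': "matrix_inv X ** X = mat 1" by (simp add: matrix_left_right_inverse)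
  let ?P = "matrix_inv X"
  have "transpose ?P ** X = mat 1"
    using arg_cong[OF inv, of transpose] assms by (simp add: matrix_transpose_mul pos_definite_def)
  then have sym: "transpose ?P = ?P" using inv by (metis matrix_mul_assoc matrix_mul_lid matrix_mul_rid)
  have "z \<bullet> (?P *v z) > 0" if "z \<noteq> 0" for z
  proof -
    have z: "X *v (?P *v z) = z" by (simp add: matrix_vector_mul_assoc inv)
    then have "?P *v z \<noteq> 0" using that by auto
    then have "(?P *v z) \<bullet> (X *v (?P *v z)) > 0" using assms by (simp add: pos_definite_def)
    then show ?thesis by (simp add: z inner_commute)
  qed
  with sym show "pos_definite ?P" by (simp add: pos_definite_def)
qed

text \<open>
The inequality is evaluated at \<open>x = P\<xi>\<close> with \<open>P = X\<^sup>-\<^sup>1\<close>. For \<open>u = y = 0\<close> it is the Lyapunov inequality of the closed loop. For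
\<open>y = (u - K\<xi>) / \<gamma>\<close>, the maximizer over \<open>y\<close>, it is the dissipation inequality. A definite form on a
finite-dimensional space is bounded by \<open>- \<epsilon> |z|\<^sup>2\<close>; this margin turns the pointwise strict bounds into one
bound \<open>sqrt (\<gamma>\<^sup>2 - \<epsilon> \<gamma>) < \<gamma>\<close> valid at all frequencies.
\<close>

lemma lmi_imp_sensitivity_bound:
  fixes A X :: "real^'n^'n" and B :: "real^'m^'n" and Y :: "real^'n^'m"
  assumes X: "pos_definite X" and lmi: "neg_definite (sensitivity_lmi A B \<gamma> X Y)" and "\<gamma> > 0"
  defines "K \<equiv> Y ** matrix_inv X"
  shows "hurwitz (A - B ** K)" and "hinf_norm (input_sensitivity A B K) < ereal \<gamma>"
proof -
  define P where "P = matrix_inv X"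
  note Pinv = pos_definite_inverse[OF X, folded P_def]
  have Xs: "transpose X = X" using X by (simp add: pos_definite_def)
  have Ps: "transpose P = P" using Pinv(3) by (simp add: pos_definite_def)
  have XP: "X *v (P *v \<xi>) = \<xi>" for \<xi> by (simp add: matrix_vector_mul_assoc Pinv)
  have YP: "Y *v (P *v \<xi>) = K *v \<xi>" for \<xi> by (simp add: K_def P_def matrix_vector_mul_assoc)
  let ?F = "A - B ** K"
  let ?z = "\<lambda>\<xi> u y. vjoin (P *v \<xi>) (vjoin u y)"
  have form: "?z \<xi> u y \<bullet> (sensitivity_lmi A B \<gamma> X Y *v ?z \<xi> u y) =
      2 * ((P *v \<xi>) \<bullet> (?F *v \<xi> + B *v u)) + 2 * (y \<bullet> (u - K *v \<xi>)) - \<gamma> * (u \<bullet> u) - \<gamma> * (y \<bullet> y)" for \<xi> u y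
    unfolding sensitivity_lmi_form[OF Xs]
    by (simp add: matrix_vector_mult_diff_rdistrib XP YP flip: matrix_vector_mul_assoc)
  show hur: "hurwitz ?F"
  proof (rule lyapunov_imp_hurwitz[OF Pinv(3)])
    fix \<xi> :: "real^'n" assume "\<xi> \<noteq> 0"
    then have "P *v \<xi> \<noteq> 0" using XP[of \<xi>] by auto
    then have "?z \<xi> 0 0 \<noteq> 0" by (simp add: vjoin_eq_0_iff)
    then have "?z \<xi> 0 0 \<bullet> (sensitivity_lmi A B \<gamma> X Y *v ?z \<xi> 0 0) < 0"
      using lmi unfolding neg_definite_def by blast
    then show "(P *v \<xi>) \<bullet> (?F *v \<xi>) < 0" unfolding form by simp
  qed
  obtain \<epsilon> where "\<epsilon> > 0" and \<epsilon>: "\<And>z. z \<bullet> (sensitivity_lmi A B \<gamma> X Y *v z) \<le> - \<epsilon> * (z \<bullet> z)"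
    by (rule compact_form_bound[of "(*v) (sensitivity_lmi A B \<gamma> X Y)"])
      (use lmi in \<open>auto simp: neg_definite_def\<close>)
  define g where "g = \<gamma>\<^sup>2 - \<epsilon> * \<gamma>"
  have diss: "2 * (((\<gamma> *\<^sub>R P) *v \<xi>) \<bullet> (?F *v \<xi> + B *v u)) + (norm (u - K *v \<xi>))\<^sup>2 \<le> g * (norm u)\<^sup>2" for \<xi> u
  proof -
    define e where "e = u - K *v \<xi>"
    define a where "a = 2 * ((P *v \<xi>) \<bullet> (?F *v \<xi> + B *v u))"
    let ?y = "(1 / \<gamma>) *\<^sub>R e"
    have "a + 2 * (?y \<bullet> e) - \<gamma> * (u \<bullet> u) - \<gamma> * (?y \<bullet> ?y) \<le> - \<epsilon> * (?z \<xi> u ?y \<bullet> ?z \<xi> u ?y)"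
      using \<epsilon>[of "?z \<xi> u ?y"] unfolding form e_def a_def .
    also have "\<dots> \<le> - \<epsilon> * (u \<bullet> u)"
      unfolding inner_vjoin using \<open>\<epsilon> > 0\<close> by simp
    finally have "a + (e \<bullet> e) / \<gamma> - \<gamma> * (u \<bullet> u) \<le> - \<epsilon> * (u \<bullet> u)"
    proof -
      assume le: "a + 2 * (?y \<bullet> e) - \<gamma> * (u \<bullet> u) - \<gamma> * (?y \<bullet> ?y) \<le> - \<epsilon> * (u \<bullet> u)"
      have "?y \<bullet> e = (e \<bullet> e) / \<gamma>" and "\<gamma> * (?y \<bullet> ?y) = (e \<bullet> e) / \<gamma>"
        using \<open>\<gamma> > 0\<close> by simp_all
      with le show ?thesis by linarith
    qed
    from mult_left_mono[OF this less_imp_le[OF \<open>\<gamma> > 0\<close>]]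
    have "\<gamma> * a + \<gamma> * ((e \<bullet> e) / \<gamma>) - \<gamma> * (\<gamma> * (u \<bullet> u)) \<le> \<gamma> * (- \<epsilon> * (u \<bullet> u))"
      by (simp only: distrib_left right_diff_distrib)
    moreover have "\<gamma> * ((e \<bullet> e) / \<gamma>) = e \<bullet> e" using \<open>\<gamma> > 0\<close> by simp
    ultimately have "\<gamma> * a + e \<bullet> e \<le> \<gamma> * (\<gamma> * (u \<bullet> u)) + \<gamma> * (- \<epsilon> * (u \<bullet> u))" by linarith
    also have "\<dots> = g * (u \<bullet> u)" by (simp add: g_def algebra_simps power2_eq_square)
    finally have "\<gamma> * a + e \<bullet> e \<le> g * (u \<bullet> u)" .
    then show ?thesis
      by (simp add: a_def e_def power2_norm_eq_inner mult_ac flip: scaleR_matrix_vector_assoc)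
  qed
  have sv: "max_singular_value (input_sensitivity A B K (\<i> * of_real \<omega>)) \<le> sqrt g" for \<omega>
  proof -
    let ?S = "input_sensitivity A B K (\<i> * of_real \<omega>)"
    obtain w where "w \<noteq> 0" and w: "norm (?S *v w) = max_singular_value ?S * norm w"
      using singular_valueE[OF max_singular_value_mem] .
    note noeig = hurwitz_no_imaginary[OF hur, of \<omega>]
    obtain f where f: "(\<i> * of_real \<omega>) *s f = cmatrix ?F *v f + cmatrix B *v w"
      using input_sensitivity_state[OF noeig] .
    have "transpose (\<gamma> *\<^sub>R P) = \<gamma> *\<^sub>R P" by (simp add: transpose_scalar Ps)
    from dissipation_imp_frequency_bound[OF this diss f]
    have "(norm (?S *v w))\<^sup>2 \<le> g * (norm w)\<^sup>2"
      by (simp add: input_sensitivity_apply[OF noeig f])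
    then have "(max_singular_value ?S)\<^sup>2 \<le> g"
      using \<open>w \<noteq> 0\<close> by (simp add: w power_mult_distrib)
    then show ?thesis by (rule real_le_rsqrt)
  qed
  have "hinf_norm (input_sensitivity A B K) \<le> ereal (sqrt g)"
    unfolding hinf_norm_def by (rule SUP_least) (simp add: sv)
  also have "sqrt g < \<gamma>"
  proof -
    have "g < \<gamma>\<^sup>2" using \<open>\<epsilon> > 0\<close> \<open>\<gamma> > 0\<close> by (simp add: g_def)
    then show ?thesis using \<open>\<gamma> > 0\<close> real_sqrt_less_mono by fastforce
  qed
  then have "ereal (sqrt g) < ereal \<gamma>" by simp
  finally show "hinf_norm (input_sensitivity A B K) < ereal \<gamma>" .
qed

text \<open>
The Kalman-Yakubovich-Popov lemma is applied to \<open>M\<^sub>1 = (I 0)\<close>, \<open>M\<^sub>2 = (F B)\<close> and the form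
\<open>|u - K\<xi>|\<^sup>2 - \<gamma>\<^sup>2 |u|\<^sup>2\<close>. Vectors with \<open>M\<^sub>1 z = 0\<close> have \<open>\<xi> = 0\<close>, where the form is
\<open>(1 - \<gamma>\<^sup>2) |u|\<^sup>2\<close>: here \<open>\<gamma> > 1\<close> enters, the sensitivity being the identity at infinite frequency. The
matrix sought is \<open>X = \<gamma> P\<^sup>-\<^sup>1\<close>.
\<close>

lemma sensitivity_bound_imp_lmi:
  fixes A :: "real^'n^'n" and B :: "real^'m^'n" and K :: "real^'n^'m"
  assumes hur: "hurwitz (A - B ** K)" and hinf: "hinf_norm (input_sensitivity A B K) < ereal \<gamma>"
    and "\<gamma> > 1"
  obtains X where "pos_definite X" and "neg_definite (sensitivity_lmi A B \<gamma> X (K ** X))"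
proof -
  let ?F = "A - B ** K"
  define E :: "real^('n + 'm)^'m" where "E = - K \<parallel> mat 1"
  define G :: "real^('n + 'm)^'m" where "G = 0 \<parallel> mat 1"
  define \<Theta> where "\<Theta> = transpose E ** E - \<gamma>\<^sup>2 *\<^sub>R (transpose G ** G)"
  let ?M1 = "mat 1 \<parallel> 0 :: real^('n + 'm)^'n"
  let ?M2 = "?F \<parallel> B"
  have gain: "norm (w - cmatrix K *v f) < \<gamma> * norm w"
    if "w \<noteq> 0" and f: "(\<i> * of_real \<omega>) *s f = cmatrix ?F *v f + cmatrix B *v w" for \<omega> :: real and f w
  proof -
    let ?S = "input_sensitivity A B K (\<i> * of_real \<omega>)"
    have "ereal (max_singular_value ?S) \<le> hinf_norm (input_sensitivity A B K)"
      unfolding hinf_norm_def by (rule SUP_upper) simp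
    then have "max_singular_value ?S < \<gamma>" using hinf by (metis ereal_less(2) order_le_less_trans less_ereal.simps(1))
    then have "norm (?S *v w) < \<gamma> * norm w"
      using norm_le_max_singular_value[of ?S w] \<open>w \<noteq> 0\<close>
      by (meson le_less_trans mult_strict_right_mono zero_less_norm_iff)
    then show ?thesis
      using input_sensitivity_apply[OF hurwitz_no_imaginary[OF hur] f] by simp
  qed
  have freq: "z \<bullet> (cmatrix \<Theta> *v z) < 0"
    if "z \<noteq> 0" and pencil: "cmatrix ?M1 *v z = 0 \<or>
      (\<exists>\<omega>::real. cmatrix ?M2 *v z = (\<i> * of_real \<omega>) *s (cmatrix ?M1 *v z))" for z
  proof -
    obtain f w where z: "z = vjoin f w" by (rule vjoin_exhaust)
    have M: "cmatrix ?M1 *v z = f" "cmatrix ?M2 *v z = cmatrix ?F *v f + cmatrix B *v w"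
      "cmatrix E *v z = w - cmatrix K *v f" "cmatrix G *v z = w"
      by (simp_all add: z cmatrix_hcat hcat_mult_vjoin cmatrix_mat cmatrix_0 cmatrix_neg neg_mult_vec
          E_def G_def)
    have "cmatrix \<Theta> = adjoint_matrix (cmatrix E) ** cmatrix E
        - \<gamma>\<^sup>2 *\<^sub>R (adjoint_matrix (cmatrix G) ** cmatrix G)"
      unfolding \<Theta>_def cmatrix_diff cmatrix_mult[symmetric] adjoint_cmatrix
      by (simp add: cmatrix_def vec_eq_iff complex_eq_iff)
    then have form: "z \<bullet> (cmatrix \<Theta> *v z) = (norm (w - cmatrix K *v f))\<^sup>2 - \<gamma>\<^sup>2 * (norm w)\<^sup>2"
      by (simp add: matrix_vector_mult_diff_rdistrib scaleR_mult_vec inner_simps inner_adjoint M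
          power2_norm_eq_inner flip: matrix_vector_mul_assoc)
    have "w \<noteq> 0 \<and> norm (w - cmatrix K *v f) < \<gamma> * norm w"
    proof (cases "f = 0")
      case True
      then have "w \<noteq> 0" using \<open>z \<noteq> 0\<close> by (simp add: z vjoin_eq_0_iff)
      with True \<open>\<gamma> > 1\<close> show ?thesis by simp
    next
      case False
      then obtain \<omega> :: real where \<omega>: "(\<i> * of_real \<omega>) *s f = cmatrix ?F *v f + cmatrix B *v w"
        using pencil M by metis
      have "w \<noteq> 0"
      proof
        assume "w = 0"
        with \<omega> False have "is_eigenvalue (cmatrix ?F) (\<i> * of_real \<omega>)"
          unfolding is_eigenvalue_def by force
        then show False using hurwitz_no_imaginary[OF hur] by blast
      qed
      with gain[OF _ \<omega>] show ?thesis by blast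
    qed
    then have "(norm (w - cmatrix K *v f))\<^sup>2 < (\<gamma> * norm w)\<^sup>2"
      by (intro power_strict_mono) auto
    then show ?thesis by (simp add: form power_mult_distrib)
  qed
  obtain P where Ps: "transpose P = P"
    and P: "\<And>z. z \<noteq> 0 \<Longrightarrow> 2 * ((P *v (?M1 *v z)) \<bullet> (?M2 *v z)) + z \<bullet> (\<Theta> *v z) < 0"
    using kalman_yakubovich_popov[OF freq] by blast
  have diss: "2 * ((P *v \<xi>) \<bullet> (?F *v \<xi> + B *v u)) + (norm (u - K *v \<xi>))\<^sup>2 - \<gamma>\<^sup>2 * (norm u)\<^sup>2 < 0"
    if "\<xi> \<noteq> 0 \<or> u \<noteq> 0" for \<xi> u
  proof -
    have "vjoin \<xi> u \<bullet> (\<Theta> *v vjoin \<xi> u) = (norm (u - K *v \<xi>))\<^sup>2 - \<gamma>\<^sup>2 * (norm u)\<^sup>2"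
      by (simp add: \<Theta>_def E_def G_def matrix_vector_mult_diff_rdistrib inner_simps inner_mult_transpose
          hcat_mult_vjoin neg_mult_vec power2_norm_eq_inner
          del: transpose_matrix_vector flip: matrix_vector_mul_assoc scaleR_matrix_vector_assoc)
    with P[of "vjoin \<xi> u"] that show ?thesis by (simp add: vjoin_eq_0_iff hcat_mult_vjoin)
  qed
  have "pos_definite P"
  proof -
    obtain Q where Q: "pos_definite Q" "\<And>z. z \<noteq> 0 \<Longrightarrow> (Q *v z) \<bullet> (?F *v z) < 0"
      using hurwitz_imp_lyapunov[OF hur] by blast
    have "(P *v \<xi>) \<bullet> (?F *v \<xi>) < 0" if "\<xi> \<noteq> 0" for \<xi>
    proof -
      have "2 * ((P *v \<xi>) \<bullet> (?F *v \<xi>)) + (norm (K *v \<xi>))\<^sup>2 < 0"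
        using diss[of \<xi> 0] that by simp
      then show ?thesis using zero_le_power2[of "norm (K *v \<xi>)"] by linarith
    qed
    from lyapunov_solution_pos_definite[OF Ps Q(1) this Q(2)] show ?thesis .
  qed
  note Pinv = pos_definite_inverse[OF this]
  define X where "X = \<gamma> *\<^sub>R matrix_inv P"
  have X: "pos_definite X"
    using Pinv(3) \<open>\<gamma> > 1\<close>
    by (simp add: X_def pos_definite_def transpose_scalar flip: scaleR_matrix_vector_assoc)
  then have Xs: "transpose X = X" by (simp add: pos_definite_def)
  have PX: "P *v (X *v x) = \<gamma> *\<^sub>R x" for x
    by (simp add: X_def matrix_vector_mult_scaleR matrix_vector_mul_assoc Pinv
        flip: scaleR_matrix_vector_assoc)
  have "z \<bullet> (sensitivity_lmi A B \<gamma> X (K ** X) *v z) < 0" if "z \<noteq> 0" for z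
  proof -
    obtain x t where zt: "z = vjoin x t" by (rule vjoin_exhaust)
    obtain u y where z: "z = vjoin x (vjoin u y)" using zt by (metis vjoin_exhaust)
    define \<xi> e where "\<xi> = X *v x" and "e = u - K *v \<xi>"
    (* completing the square in y *)
    have "\<gamma> * (z \<bullet> (sensitivity_lmi A B \<gamma> X (K ** X) *v z)) =
        (2 * ((P *v \<xi>) \<bullet> (?F *v \<xi> + B *v u)) + (norm e)\<^sup>2 - \<gamma>\<^sup>2 * (norm u)\<^sup>2) - (norm (\<gamma> *\<^sub>R y - e))\<^sup>2"
    proof -
      have sq: "(norm (\<gamma> *\<^sub>R y - e))\<^sup>2 = \<gamma>\<^sup>2 * (y \<bullet> y) - 2 * \<gamma> * (y \<bullet> e) + (norm e)\<^sup>2"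
        unfolding power2_norm_eq_inner
        by (simp add: inner_simps inner_commute power2_eq_square algebra_simps)
      have form: "z \<bullet> (sensitivity_lmi A B \<gamma> X (K ** X) *v z) =
          2 * (x \<bullet> (?F *v \<xi> + B *v u)) + 2 * (y \<bullet> e) - \<gamma> * (u \<bullet> u) - \<gamma> * (y \<bullet> y)"
        unfolding z sensitivity_lmi_form[OF Xs]
        by (simp add: matrix_vector_mult_diff_rdistrib \<xi>_def e_def flip: matrix_vector_mul_assoc)
      show ?thesis
        unfolding sq form by (simp add: \<xi>_def PX dot_square_norm power2_eq_square algebra_simps)
    qed
    also have "\<dots> < 0"
    proof (cases "\<xi> \<noteq> 0 \<or> u \<noteq> 0")
      case True
      from diss[OF this] show ?thesis unfolding e_def using zero_le_power2[of "norm (\<gamma> *\<^sub>R y - (u - K *v \<xi>))"] by linarith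
    next
      case False
      then have "x = 0" using PX[of x] \<open>\<gamma> > 1\<close> by (simp add: \<xi>_def)
      then have "y \<noteq> 0" using \<open>z \<noteq> 0\<close> False by (simp add: z vjoin_eq_0_iff)
      with False \<open>\<gamma> > 1\<close> show ?thesis by (simp add: e_def)
    qed
    finally show ?thesis using \<open>\<gamma> > 1\<close> by (simp add: mult_less_0_iff)
  qed
  then have "neg_definite (sensitivity_lmi A B \<gamma> X (K ** X))"
    unfolding neg_definite_def using sensitivity_lmi_symmetric[OF Xs] by blast
  with X that show ?thesis by blast
qed

section \<open>Safety constraints under linear feedback\<close>

lemma affine_nonneg_iff:
  fixes w :: "'a::real_inner"
  assumes "b \<ge> 0"
  shows "(\<forall>x. w \<bullet> x + b \<ge> 0) \<longleftrightarrow> w = 0"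
proof
  assume all: "\<forall>x. w \<bullet> x + b \<ge> 0"
  show "w = 0"
  proof (rule ccontr)
    assume "w \<noteq> 0"
    have "w \<bullet> ((- (b + 1) / (w \<bullet> w)) *\<^sub>R w) + b \<ge> 0" using all by blast
    with \<open>w \<noteq> 0\<close> show False by simp
  qed
qed (use assms in simp)

text \<open>
The constraint has to hold on the whole state space, so its part that is linear in \<open>x\<close> must vanish.
\<close>

lemma hocbf_linear_feedback_iff:
  assumes "d \<ge> 0" and "\<And>j. j \<in> {1..r} \<Longrightarrow> a j > 0"
  shows "(\<forall>x. hocbf_constraint A B c d r a x (- (K *v x))) \<longleftrightarrow>
    (c v* (matpow A (r - 1) ** B)) v* K = c v* Phi A a r"
proof -
  let ?l = "c v* (matpow A (r - 1) ** B)"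
  have "hocbf_constraint A B c d r a x (- (K *v x)) \<longleftrightarrow>
      (c v* Phi A a r - ?l v* K) \<bullet> x + (\<Prod>j=1..r. a j) * d \<ge> 0" for x
    by (simp add: hocbf_constraint_def inner_diff_left dot_lmul_matrix)
  moreover have "(\<Prod>j=1..r. a j) * d \<ge> 0"
    using assms by (intro mult_nonneg_nonneg prod_nonneg) (auto intro: less_imp_le)
  ultimately show ?thesis
    using affine_nonneg_iff[of "(\<Prod>j=1..r. a j) * d" "c v* Phi A a r - ?l v* K"]
    by (simp only: right_minus_eq) (rule eq_commute)
qed

text \<open>
This makes \<open>L (L\<^sup>T L)\<^sup>-\<^sup>1 C\<close> a solution of \<open>L\<^sup>T K = C\<close>.
\<close>

lemma gram_right_inverse:
  fixes L :: "real^'p^'m"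
  assumes "\<And>x. L *v x = 0 \<Longrightarrow> x = 0"
  shows "transpose L ** (L ** matrix_inv (transpose L ** L)) = mat 1"
proof -
  have "x = 0" if "(transpose L ** L) *v x = 0" for x
  proof -
    have "x \<bullet> (transpose L *v (L *v x)) = 0"
      using that by (simp del: transpose_matrix_vector add: matrix_vector_mul_assoc)
    then have "L *v x = 0" by (simp add: inner_mult_transpose del: transpose_matrix_vector)
    then show ?thesis by (rule assms)
  qed
  then obtain N where "N ** (transpose L ** L) = mat 1"
    using matrix_left_invertible_ker[of "transpose L ** L"] by blast
  then have "(transpose L ** L) ** N = mat 1" by (simp add: matrix_left_right_inverse)
  then show ?thesis using matrix_inv_unique[of "transpose L ** L" N] by (simp add: matrix_mul_assoc)
qed

lemma independent_family_columns_injective: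
  fixes v :: "'p::finite \<Rightarrow> real^'m"
  assumes "inj v" and "independent (range v)" and "(\<chi> a k. v k $ a) *v x = 0"
  shows "x = 0"
proof -
  have "(\<Sum>k\<in>UNIV. x $ k *\<^sub>R v k) = 0"
    using assms(3) by (simp add: vec_eq_iff matrix_vector_mult_def mult.commute)
  then have "(\<Sum>w\<in>range v. x $ (inv v w) *\<^sub>R w) = 0"
    using assms(1) by (simp add: sum.reindex)
  then have "x $ (inv v (v k)) = 0" for k
    using independentD[OF assms(2), of "range v" "\<lambda>w. x $ inv v w" "v k"] by simp
  then show ?thesis using assms(1) by (simp add: vec_eq_iff)
qed

lemma vector_matrix_row: "(M ** N) $ k = (M $ k) v* N"
  by (simp add: matrix_matrix_mult_def vector_matrix_mult_def vec_eq_iff mult.commute)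

section \<open>Safe stabilizing gains with bounded sensitivity\<close>

theorem proposition7:
  fixes A :: "real^'n^'n" and B :: "real^'m^'n"
    and p pbar :: nat
    and c :: "nat \<Rightarrow> real^'n" and d :: "nat \<Rightarrow> real" and r :: "nat \<Rightarrow> nat"
    and \<alpha> :: "nat \<Rightarrow> nat \<Rightarrow> real"
    and e :: "'p::finite \<Rightarrow> nat"
    and ell :: "nat \<Rightarrow> real^'m"
    and L :: "real^'p^'m" and Ct :: "real^'n^'p" and K0 :: "real^'n^'m"
    and Lperp :: "(real^'m) list"
    and \<gamma> :: real
  assumes ell: "\<And>i. ell i = transpose B *v (transpose (matpow A (r i - 1)) *v c i)"
    and L: "L = (\<chi> a k. ell (e k) $ a)"
    and Ct: "Ct = (\<chi> k. c (e k) v* Phi A (\<alpha> (e k)) (r (e k)))"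
    and K0: "K0 = L ** matrix_inv (transpose L ** L) ** Ct"
    and "p \<le> pbar"
    and columns_enum: "bij_betw e (UNIV :: 'p set) {1..p}"
    and rel_deg: "\<And>i. i \<in> {1..pbar} \<Longrightarrow> relative_degree A B (c i) (r i)"
    and alpha_pos: "\<And>i j. i \<in> {1..pbar} \<Longrightarrow> j \<in> {1..r i} \<Longrightarrow> \<alpha> i j > 0"
    and lin_indep: "inj_on ell {1..p}" "independent (ell ` {1..p})"
    and lin_comb: "\<And>i. i \<in> {p+1..pbar} \<Longrightarrow> ell i \<in> span (ell ` {1..p})"
    and Lperp: "length Lperp = CARD('m) - p" "basis_of_kernel Lperp (transpose L)"
    and cond1: "\<And>i. i \<in> {1..pbar} \<Longrightarrow> d i \<ge> 0"
    and cond2: "\<And>i. i \<in> {1..pbar} - {1..p} \<Longrightarrow> c i v* Phi A (\<alpha> i) (r i) - ell i v* K0 = 0"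
    and cond3: "stabilizable (A - B ** K0) (map ((*v) B) Lperp)"
    and gamma: "\<gamma> > 1"
  shows "((\<exists>K \<in> safe_stabilizing_gains A B pbar c d r \<alpha>. hinf_norm (input_sensitivity A B K) < ereal \<gamma>)
           \<longleftrightarrow> (\<exists>X Y. sensitivity_feasible A B L Ct \<gamma> X Y)) \<and>
         (\<forall>X Y. sensitivity_feasible A B L Ct \<gamma> X Y \<longrightarrow>
           Y ** matrix_inv X \<in> safe_stabilizing_gains A B pbar c d r \<alpha> \<and>
           hinf_norm (input_sensitivity A B (Y ** matrix_inv X)) < ereal \<gamma>)"
proof -
  have ell': "ell i = c i v* (matpow A (r i - 1) ** B)" for i
    by (simp add: ell vector_matrix_mul_assoc)
  have Lrow: "(transpose L ** K) $ k = ell (e k) v* K" for K :: "real^'n^'m" and k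
    by (simp add: vector_matrix_row) (simp add: L transpose_def)
  have range_e: "e k \<in> {1..p}" for k using columns_enum by (auto simp: bij_betw_def)
  have LK_iff: "transpose L ** K = Ct \<longleftrightarrow>
      (\<forall>i\<in>{1..p}. ell i v* K = c i v* Phi A (\<alpha> i) (r i))" for K
  proof -
    have "transpose L ** K = Ct \<longleftrightarrow>
        (\<forall>k. ell (e k) v* K = c (e k) v* Phi A (\<alpha> (e k)) (r (e k)))"
      by (subst vec_eq_iff) (simp add: Lrow Ct)
    also have "\<dots> \<longleftrightarrow> (\<forall>i\<in>range e. ell i v* K = c i v* Phi A (\<alpha> i) (r i))" by simp
    also have "range e = {1..p}" using columns_enum by (simp add: bij_betw_def)
    finally show ?thesis .
  qed
  have LK0: "transpose L ** K0 = Ct"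
  proof -
    have inj: "inj (\<lambda>k. ell (e k))"
      using comp_inj_on[of e UNIV ell] columns_enum lin_indep(1) by (simp add: bij_betw_def comp_def)
    have "range (\<lambda>k. ell (e k)) = ell ` {1..p}"
      using columns_enum image_image[of ell e UNIV] by (simp add: bij_betw_def)
    then have "L *v x = 0 \<Longrightarrow> x = 0" for x
      using independent_family_columns_injective[OF inj] lin_indep(2) by (simp add: L)
    then have "transpose L ** (L ** matrix_inv (transpose L ** L)) = mat 1"
      by (rule gram_right_inverse)
    moreover have "transpose L ** K0 = (transpose L ** (L ** matrix_inv (transpose L ** L))) ** Ct"
      by (simp only: K0 matrix_mul_assoc)
    ultimately show ?thesis by simp
  qed
  have span_agree: "v v* K = v v* K0" if "transpose L ** K = Ct" "v \<in> span (ell ` {1..p})" for K v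
  proof -
    have "subspace {v. v v* K = v v* K0}"
      by (auto simp: subspace_def vector_matrix_left_distrib scaleR_vector_matrix_assoc)
    moreover have "ell ` {1..p} \<subseteq> {v. v v* K = v v* K0}"
      using that(1) LK0 by (auto simp: LK_iff)
    ultimately have "span (ell ` {1..p}) \<subseteq> {v. v v* K = v v* K0}" by (intro span_minimal)
    with that(2) show ?thesis by blast
  qed
  have gains_iff: "K \<in> safe_stabilizing_gains A B pbar c d r \<alpha> \<longleftrightarrow>
      hurwitz (A - B ** K) \<and> transpose L ** K = Ct" for K
  proof -
    have "(\<forall>x. hocbf_constraint A B (c i) (d i) (r i) (\<alpha> i) x (- (K *v x))) \<longleftrightarrow>
        ell i v* K = c i v* Phi A (\<alpha> i) (r i)" if "i \<in> {1..pbar}" for i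
      unfolding ell' using cond1[OF that] alpha_pos[OF that] by (rule hocbf_linear_feedback_iff)
    then have "K \<in> safe_stabilizing_gains A B pbar c d r \<alpha> \<longleftrightarrow> hurwitz (A - B ** K) \<and>
        (\<forall>i\<in>{1..pbar}. ell i v* K = c i v* Phi A (\<alpha> i) (r i))"
      unfolding safe_stabilizing_gains_def by blast
    moreover have "ell i v* K = c i v* Phi A (\<alpha> i) (r i)"
      if "transpose L ** K = Ct" "i \<in> {1..pbar}" for i
    proof (cases "i \<in> {1..p}")
      case True
      then show ?thesis using that(1) by (simp add: LK_iff)
    next
      case False
      then have "ell i \<in> span (ell ` {1..p})" using that(2) by (intro lin_comb) auto
      then have "ell i v* K = ell i v* K0" using span_agree that(1) by blast
      then show ?thesis using cond2[of i] False that(2) by simp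
    qed
    ultimately show ?thesis using \<open>p \<le> pbar\<close> by (auto simp: LK_iff)
  qed
  have sufficient: "Y ** matrix_inv X \<in> safe_stabilizing_gains A B pbar c d r \<alpha> \<and>
      hinf_norm (input_sensitivity A B (Y ** matrix_inv X)) < ereal \<gamma>"
    if "sensitivity_feasible A B L Ct \<gamma> X Y" for X Y
  proof -
    have X: "pos_definite X" and lmi: "neg_definite (sensitivity_lmi A B \<gamma> X Y)"
      and LY: "transpose L ** Y = Ct ** X"
      using that by (auto simp: sensitivity_feasible_def)
    have "transpose L ** (Y ** matrix_inv X) = Ct ** (X ** matrix_inv X)"
      by (simp add: matrix_mul_assoc LY)
    then have "transpose L ** (Y ** matrix_inv X) = Ct" by (simp add: pos_definite_inverse[OF X])
    with lmi_imp_sensitivity_bound[OF X lmi] gamma show ?thesis by (simp add: gains_iff)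
  qed
  have necessary: "\<exists>X Y. sensitivity_feasible A B L Ct \<gamma> X Y"
    if K: "K \<in> safe_stabilizing_gains A B pbar c d r \<alpha>"
      and bound: "hinf_norm (input_sensitivity A B K) < ereal \<gamma>" for K
  proof -
    have hur: "hurwitz (A - B ** K)" and LK: "transpose L ** K = Ct" using K by (auto simp: gains_iff)
    obtain X where "pos_definite X" "neg_definite (sensitivity_lmi A B \<gamma> X (K ** X))"
      using sensitivity_bound_imp_lmi[OF hur bound gamma] .
    moreover have "transpose L ** (K ** X) = Ct ** X" by (simp add: matrix_mul_assoc LK)
    ultimately show ?thesis unfolding sensitivity_feasible_def by blast
  qed
  show ?thesis using sufficient necessary by blast
qed

end
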